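(* Let $F$ be an analytic function on $\Lambda=\mathbb C\setminus[1,+\infty)$ with $F(0)=1$. Suppose that the restriction of $F$ to the upper half-plane $\mathbb H=\{z:\operatorname{Im}z>0\}$ analytically extends across the slit $(1,+\infty)$ to a function $F^+$. Suppose that the following five conditions are satisfied: (1) $F(x)\in\mathbb R$ for all $x\in(-\infty,1)$; (2) $\limsup_{x\to-\infty}F(x)\ge 0$; (3) $\operatorname{Im}F^+(x)\ge 0$ for all $x\in(1,+\infty)$; (4) $F(z)=O(|z|^{\alpha})$ as $z\to\infty$ in $\mathbb H$ for some constant $\alpha<1$; (5) $F(z)=O(|z-1|^{-\alpha})$ as $z\to 1$ in $\mathbb H$ for some constant $\alpha<1$. Then $F\in\mathcal T$. Moreover, $F(z)=\int_0^1\frac{d\mu(t)}{1-tz}$ for $z\in\Lambda$, where $\mu$ is the Borel probability measure on $[0,1]$ determined by $$d\mu(t)=\alpha_0\,d\delta_0(t)+\alpha_1\,d\delta_1(t)+\frac{\operatorname{Im}F^+(1/t)}{\pi t}\,dt,$$ where $\delta_0$ and $\delta_1$ are the Dirac measures with unit mass at $t=0$ and $t=1$, respectively, and $$\alpha_0=\lim_{x\to-\infty}F(x)\quad\text{and}\quad \alpha_1=\lim_{x\to1^-}(1-x)F(x).$$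
   Context: The class $\mathcal T$ is the set of analytic functions $F$ on $\Lambda=\mathbb C\setminus[1,+\infty)$ for which there is a Borel probability measure $\mu$ on $[0,1]$ with $F(z)=\int_0^1\frac{d\mu(t)}{1-tz}$ for all $z\in\Lambda$. That $F|_{\mathbb H}$ analytically extends across $(1,+\infty)$ to $F^+$ means that $F^+$ is analytic on an open set containing $\mathbb H\cup(1,+\infty)$ and coincides with $F$ on $\mathbb H$. The last term in the formula for $d\mu$ is an absolutely continuous measure on $(0,1)$. *)

theory Defs
  imports
    "HOL-Complex_Analysis.Complex_Analysis"
    "HOL-Probability.Probability"
    "HOL-Library.Landau_Symbols"
begin

definition slit_plane :: "complex set" where
  "slit_plane = - (complex_of_real ` {1..})"

definition upper_half_plane :: "complex set" where
  "upper_half_plane = {z. Im z > 0}"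

definition borel_prob_unit_interval :: "real measure \<Rightarrow> bool" where
  "borel_prob_unit_interval \<mu> \<longleftrightarrow>
     prob_space \<mu> \<and> sets \<mu> = sets (restrict_space borel {0..1})"

text \<open>For \<open>z\<close> in the slit plane the integrand is bounded and continuous on the unit interval,
  so the Bochner integral is never the junk value of a non-integrable function.\<close>

definition represents :: "real measure \<Rightarrow> (complex \<Rightarrow> complex) \<Rightarrow> bool" where
  "represents \<mu> F \<longleftrightarrow>
     (\<forall>z\<in>slit_plane. F z = (\<integral>t. 1 / (1 - complex_of_real t * z) \<partial>\<mu>))"

text \<open>Functions are total in HOL; only the values on the slit plane matter here.\<close>

definition class_T :: "(complex \<Rightarrow> complex) set" where
  "class_T = {F. F analytic_on slit_plane \<and>
                 (\<exists>\<mu>. borel_prob_unit_interval \<mu> \<and> represents \<mu> F)}"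

definition extends_across_slit :: "(complex \<Rightarrow> complex) \<Rightarrow> (complex \<Rightarrow> complex) \<Rightarrow> bool" where
  "extends_across_slit F Fp \<longleftrightarrow>
     (\<exists>U. open U \<and> upper_half_plane \<union> complex_of_real ` {1<..} \<subseteq> U \<and>
          Fp analytic_on U \<and> (\<forall>z\<in>upper_half_plane. Fp z = F z))"

text \<open>The equation \<open>d\<mu> = a\<^sub>0 d\<delta>\<^sub>0 + a\<^sub>1 d\<delta>\<^sub>1 + w(t) dt\<close> between Borel measures on the unit
  interval, with \<open>w\<close> living on the open interval. Since \<open>ennreal\<close> truncates negative reals to 0,
  nonnegativity of the coefficients and of \<open>w\<close> is part of the definition.\<close>

definition has_decomposition :: "real measure \<Rightarrow> real \<Rightarrow> real \<Rightarrow> (real \<Rightarrow> real) \<Rightarrow> bool" where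
  "has_decomposition \<mu> a0 a1 w \<longleftrightarrow>
     0 \<le> a0 \<and> 0 \<le> a1 \<and> (\<forall>t\<in>{0<..<1}. 0 \<le> w t) \<and>
     set_borel_measurable lborel {0<..<1} w \<and>
     sets \<mu> = sets (restrict_space borel {0..1}) \<and>
     (\<forall>A\<in>sets \<mu>. emeasure \<mu> A =
        ennreal a0 * indicator A 0 + ennreal a1 * indicator A 1 +
        (\<integral>\<^sup>+t\<in>A \<inter> {0<..<1}. ennreal (w t) \<partial>lborel))"

end

theory Submission
  imports Defs "HOL-Real_Asymp.Real_Asymp"
begin

text \<open>
  The growth conditions make \<open>q(z) = (F(z) - 1) / z\<close> decay at infinity and locally integrable along
  the boundary of the upper half-plane, so Cauchy's formula holds there without an arc at infinity:
  the boundary integral of \<open>q(x) / (x - z)\<close> is \<open>2\<pi>i q(z)\<close> for \<open>Im z > 0\<close> and \<open>0\<close> for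
  \<open>Im z < 0\<close>. Subtracting from the formula at \<open>z\<close> the conjugate of the one at the reflected point
  leaves only \<open>Im q\<close> on the real line, which vanishes to the left of \<open>1\<close>. After \<open>x = 1/t\<close> this
  reads, with \<open>w\<close> the density of the theorem,
  \<open>F(z) = 1 + \<integral> w(t) (1 / (1 - tz) - 1) dt\<close>; reflection and continuity carry it to the whole slit
  plane. Along the negative axis \<open>F\<close> is then monotone, so the condition on the limsup gives \<open>F \<ge> 0\<close>
  there, and monotone convergence yields \<open>\<integral> w \<le> 1\<close>, the missing mass being \<open>\<alpha>\<^sub>0\<close>. The growth
  condition at \<open>1\<close> forces \<open>\<alpha>\<^sub>1 = 0\<close>.
\<close>

subsection \<open>Cauchy integral formula on half-discs\<close>

text \<open>Cauchy's formula for the constant 1 on the full circle, split at the angle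
  \<open>pi\<close>. The split allows the lower half to be traded for the diameter when the winding
  number of a half-disc boundary is computed.\<close>

lemma has_contour_integral_half_circles:
  assumes "0 < Im z" "norm z < R"
  obtains I J where
    "((\<lambda>w. 1 / (w - z)) has_contour_integral I) (part_circlepath 0 R 0 pi)"
    "((\<lambda>w. 1 / (w - z)) has_contour_integral J) (part_circlepath 0 R pi (2*pi))"
    "I + J = 2 * pi * \<i>"
proof -
  have R: "R > 0" using assms(2) norm_ge_zero[of z] by linarith
  have sub: "path_image (part_circlepath 0 R a b) \<subseteq> sphere 0 R" if "a \<le> b" for a b
    using path_image_part_circlepath_subset[of a b R 0] that R by auto
  have c: "(\<lambda>w. 1 / (w - z)) contour_integrable_on part_circlepath 0 R a b" if "a \<le> b" for a b
    using sub[OF that] assms(2)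
    by (intro contour_integrable_continuous_part_circlepath continuous_intros) auto
  have "(\<lambda>w. 1 / (w - z)) contour_integrable_on part_circlepath 0 R 0 pi"
    "(\<lambda>w. 1 / (w - z)) contour_integrable_on part_circlepath 0 R pi (2*pi)"
    by (auto intro: c)
  then obtain I J where
    I: "((\<lambda>w. 1 / (w - z)) has_contour_integral I) (part_circlepath 0 R 0 pi)" and
    J: "((\<lambda>w. 1 / (w - z)) has_contour_integral J) (part_circlepath 0 R pi (2*pi))"
    unfolding contour_integrable_on_def by blast
  have "((\<lambda>w. 1 / (w - z)) has_contour_integral (I + J)) (part_circlepath 0 R 0 (2*pi))"
    using I J by (simp add: has_contour_integral_part_circlepath_iff has_integral_combine[where c = pi])
  moreover have "((\<lambda>w. 1 / (w - z)) has_contour_integral (2 * pi * \<i>)) (circlepath 0 R)"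
    using Cauchy_integral_circlepath_simple[of "\<lambda>_. 1" 0 R z] assms by auto
  ultimately have "I + J = 2 * pi * \<i>"
    unfolding circlepath_def using contour_integral_unique by metis
  then show thesis using that I J by blast
qed

text \<open>The lower half-circle, closed up by the reversed diameter, stays in the convex
  half-plane below the level of \<open>z\<close>, where 1/(w - z) is holomorphic. Hence the diameter
  may replace the lower half-circle in the full circle, around which the integral is known.\<close>

lemma winding_number_upper_half_disc:
  assumes "0 < Im z" "norm z < R"
  shows "winding_number (part_circlepath 0 R 0 pi +++ linepath (- of_real R) (of_real R)) z = 1"
    (is "winding_number ?g z = 1")
proof -
  have R: "R > 0" using assms(2) norm_ge_zero[of z] by linarith
  define f where "f = (\<lambda>w. 1 / (w - z))"
  obtain I J where I: "(f has_contour_integral I) (part_circlepath 0 R 0 pi)"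
    and J: "(f has_contour_integral J) (part_circlepath 0 R pi (2*pi))"
    and IJ: "I + J = 2 * pi * \<i>"
    using has_contour_integral_half_circles[OF assms] unfolding f_def by metis
  have seg: "closed_segment (- of_real R) (of_real R) \<subseteq> {w. Im w = 0}"
    by (auto simp: closed_segment_def)
  have "f contour_integrable_on linepath (- of_real R) (of_real R)"
    unfolding f_def using seg assms(1)
    by (intro contour_integrable_continuous_linepath continuous_intros) auto
  then obtain K where K: "(f has_contour_integral K) (linepath (- of_real R) (of_real R))"
    unfolding contour_integrable_on_def by blast
  have K': "(f has_contour_integral - K) (linepath (of_real R) (- of_real R))"
    using has_contour_integral_reversepath[OF _ K] by simp
  have ends: "pathfinish (part_circlepath 0 R 0 pi) = - of_real R"
    "pathstart (part_circlepath 0 R 0 pi) = of_real R"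
    "pathstart (part_circlepath 0 R pi (2*pi)) = - of_real R"
    "pathfinish (part_circlepath 0 R pi (2*pi)) = of_real R"
    by (simp_all add: exp_Euler)
  have "exp (\<i> * (2 * complex_of_real pi)) = 1"
    by (metis exp_two_pi_i mult.commute)
  note ends = ends this
  have low: "path_image (part_circlepath 0 R pi (2*pi)) \<subseteq> {w. Im w < Im z}"
  proof
    fix w assume "w \<in> path_image (part_circlepath 0 R pi (2*pi))"
    then obtain t where t: "w = 0 + R * cis t" "pi \<le> t" "t \<le> 2*pi"
      unfolding path_image_part_circlepath' image_iff closed_segment_eq_real_ivl by force
    then have "Im w = R * sin t" by simp
    moreover have "sin t \<le> 0" using t sin_ge_zero[of "t - pi"] by (simp add: sin_diff)
    ultimately show "w \<in> {w. Im w < Im z}" using R assms(1)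
      by (smt (verit, best) mem_Collect_eq mult_nonneg_nonpos)
  qed
  have "(f has_contour_integral 0) (part_circlepath 0 R pi (2*pi) +++ linepath (of_real R) (- of_real R))"
  proof (rule Cauchy_theorem_convex_simple[where S = "{w. Im w < Im z}"])
    show "f holomorphic_on {w. Im w < Im z}"
      unfolding f_def by (intro holomorphic_intros) auto
    show "convex {w. Im w < Im z}" by (rule convex_halfspace_Im_lt)
    show "path_image (part_circlepath 0 R pi (2*pi) +++ linepath (of_real R) (- of_real R))
        \<subseteq> {w. Im w < Im z}"
      using low seg assms(1) by (subst path_image_join)
        (auto simp: ends closed_segment_commute[of "of_real R"])
  qed (simp_all add: ends)
  moreover have "(f has_contour_integral (J + - K)) (part_circlepath 0 R pi (2*pi) +++ linepath (of_real R) (- of_real R))"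
    by (rule has_contour_integral_join[OF J K']) (simp_all add: ends)
  ultimately have JK: "J = K" using has_contour_integral_unique by fastforce
  have "(f has_contour_integral (I + K)) ?g"
    by (rule has_contour_integral_join[OF I K]) (simp_all add: ends)
  then have "contour_integral ?g f = 2 * pi * \<i>"
    using IJ JK by (simp add: contour_integral_unique)
  moreover have "z \<notin> path_image ?g"
    using path_image_part_circlepath_subset[of 0 pi R 0] assms seg R
    by (subst path_image_join) (auto simp: ends)
  ultimately show ?thesis
    unfolding f_def by (subst winding_number_valid_path) (auto simp: ends)
qed


text \<open>The strip of width \<open>e\<close> below the real axis supplies an open convex domain
  around the closed half-disc. The point \<open>z\<close> lies either inside the half-disc or
  outside this domain, so the same contour yields Cauchy's formula or Cauchy's theorem. The error is
  the arc, of length pi R, on which |w - z| is at least R - |z|.\<close>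

lemma Cauchy_upper_half_disc:
  fixes f :: "complex \<Rightarrow> complex"
  assumes hol: "f holomorphic_on {w. - e < Im w}" and e: "e > 0"
    and z: "0 < Im z \<or> Im z \<le> - e" and R: "norm z < R"
    and bound: "\<And>w. norm w = R \<Longrightarrow> 0 \<le> Im w \<Longrightarrow> norm (f w) \<le> B"
  shows "norm ((\<integral>x. indicator {-R..R} x *\<^sub>R (f (of_real x) / (of_real x - z)) \<partial>lborel)
           - (if 0 < Im z then 2 * pi * \<i> * f z else 0)) \<le> B / (R - norm z) * R * pi"
proof -
  let ?S = "{w. - e < Im w}" and ?up = "part_circlepath 0 R 0 pi"
  let ?line = "linepath (- of_real R) (of_real R) :: real \<Rightarrow> complex"
  let ?h = "\<lambda>w. f w / (w - z)"
  define c where "c = (if 0 < Im z then 2 * pi * \<i> * f z else 0)"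
  have R0: "R > 0" using R norm_ge_zero[of z] by linarith
  have conv: "convex ?S" by (rule convex_halfspace_Im_gt)
  have opn: "open ?S" by (rule open_halfspace_Im_gt)
  have seg: "closed_segment (- of_real R) (of_real R) \<subseteq> {w. Im w = 0}"
    by (auto simp: closed_segment_def)
  have up: "path_image ?up \<subseteq> {w. norm w = R \<and> 0 \<le> Im w}"
  proof
    fix w assume "w \<in> path_image ?up"
    then obtain t where t: "w = 0 + R * cis t" "0 \<le> t" "t \<le> pi"
      unfolding path_image_part_circlepath' image_iff closed_segment_eq_real_ivl by force
    then have "Im w = R * sin t" "norm w = R" using R0 by (simp_all add: norm_mult)
    then show "w \<in> {w. norm w = R \<and> 0 \<le> Im w}" using R0 t sin_ge_zero by simp
  qed
  have img: "path_image (?up +++ ?line) \<subseteq> ?S - {z}"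
  proof -
    have "z \<notin> closed_segment (- of_real R) (of_real R)" "z \<notin> path_image ?up"
      using up seg z e R by auto
    moreover have "path_image ?up \<subseteq> ?S" "closed_segment (- of_real R) (of_real R) \<subseteq> ?S"
      using up seg e by force+
    ultimately show ?thesis by (subst path_image_join) auto
  qed
  have "(?h has_contour_integral c) (?up +++ ?line)"
  proof (cases "0 < Im z")
    case True
    have "(?h has_contour_integral
        2 * pi * \<i> * winding_number (?up +++ ?line) z * f z) (?up +++ ?line)"
      using img True e
      by (intro Cauchy_integral_formula_convex_simple[OF conv hol])
         (auto simp: interior_open[OF opn])
    then show ?thesis
      using winding_number_upper_half_disc[OF True R] True by (simp add: c_def)
  next
    case False
    have "?h holomorphic_on ?S"
      using False z by (intro holomorphic_intros hol) auto
    then have "(?h has_contour_integral 0) (?up +++ ?line)"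
      using img by (intro Cauchy_theorem_convex_simple[OF _ conv]) auto
    then show ?thesis using False by (simp add: c_def)
  qed
  then have "?h contour_integrable_on (?up +++ ?line)" and c: "contour_integral (?up +++ ?line) ?h = c"
    by (auto simp: contour_integrable_on_def contour_integral_unique)
  then have int: "?h contour_integrable_on ?up" "?h contour_integrable_on ?line"
    by simp_all
  define I J where "I = contour_integral ?up ?h" and "J = contour_integral ?line ?h"
  have I: "(?h has_contour_integral I) ?up" and J: "(?h has_contour_integral J) ?line"
    using int by (simp_all add: I_def J_def has_contour_integral_integral)
  have IJ: "c = I + J"
    using c int by (simp add: I_def J_def)
  have "norm I \<le> B / (R - norm z) * R * (pi - 0)"
  proof (rule has_contour_integral_bound_part_circlepath[OF I])
    \<comment> \<open>The arc estimate needs a nonnegative constant; the endpoint R of the arc shows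
      that \<open>B\<close> is one.\<close>
    have "norm (f (of_real R)) \<le> B" using bound[of "of_real R"] R0 by simp
    then have "0 \<le> B" by (rule order_trans[OF norm_ge_zero])
    then show "0 \<le> B / (R - norm z)" using R by simp
    fix w assume "w \<in> path_image ?up"
    then have w: "norm w = R" "0 \<le> Im w" using up by auto
    have "R - norm z \<le> norm (w - z)" using w norm_triangle_ineq2[of w z] by simp
    then show "norm (?h w) \<le> B / (R - norm z)"
      using bound[OF w] R \<open>0 \<le> B\<close> by (auto simp: norm_divide intro!: frac_le)
  qed (use R0 in auto)
  moreover have "(\<integral>x. indicator {-R..R} x *\<^sub>R (f (of_real x) / (of_real x - z)) \<partial>lborel) = J"
  proof -
    have "continuous_on {-R..R} (\<lambda>x. f (of_real x) / (of_real x - z))"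
      using z e
      by (intro continuous_intros continuous_on_compose2[OF holomorphic_on_imp_continuous_on[OF hol]])
         auto
    then have "set_integrable lborel {-R..R} (\<lambda>x. f (of_real x) / (of_real x - z))"
      by (rule borel_integrable_atLeastAtMost')
    then have "(\<integral>x. indicator {-R..R} x *\<^sub>R (f (of_real x) / (of_real x - z)) \<partial>lborel)
        = integral {-R..R} (\<lambda>x. f (of_real x) / (of_real x - z))"
      using set_borel_integral_eq_integral(2) unfolding set_lebesgue_integral_def by blast
    also have "\<dots> = J"
      using J R0 by (subst (asm) has_contour_integral_linepath_Reals_iff) (auto intro: integral_unique)
    finally show ?thesis .
  qed
  ultimately show ?thesis
    unfolding c_def[symmetric] IJ by (simp add: norm_minus_commute)
qed

subsection \<open>Cauchy integral formula on the upper half-plane\<close>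

text \<open>The model majorant: it behaves like |x|^(-a) at 0, integrable because a < 1, and like
  |x|^(-a-1) at infinity, integrable because a > 0.\<close>

lemma integrable_powr_div_abs:
  fixes a :: real
  assumes "0 < a" "a < 1"
  shows "integrable lborel (\<lambda>x. \<bar>x\<bar> powr - a / (1 + \<bar>x\<bar>))"
proof -
  define h where "h = (\<lambda>x::real. indicator {0..} x * (x powr - a / (1 + x)))"
  have "set_integrable lebesgue {0..1} (\<lambda>x::real. x powr - a)"
    using assms by (intro nonnegative_absolutely_integrable_1 integrable_on_powr_from_0) auto
  then have 1: "integrable lborel (\<lambda>x. indicator {0..1} x * x powr - a)"
    unfolding set_integrable_def by (subst (asm) integrable_completion) simp_all
  have "(\<lambda>x::real. x powr (- a - 1)) integrable_on {1..}"
    using has_integral_powr_to_inf[of "- a - 1" 1] assms unfolding integrable_on_def by auto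
  then have "set_integrable lebesgue {1..} (\<lambda>x::real. x powr (- a - 1))"
    by (intro nonnegative_absolutely_integrable_1) auto
  then have 2: "integrable lborel (\<lambda>x. indicator {1..} x * x powr (- a - 1))"
    unfolding set_integrable_def by (subst (asm) integrable_completion) simp_all
  have h: "integrable lborel h"
  proof (rule Bochner_Integration.integrable_bound[OF Bochner_Integration.integrable_add[OF 1 2]], unfold h_def)
    show "AE x in lborel. norm (indicator {0..} x * (x powr - a / (1 + x)))
        \<le> norm (indicator {0..1} x * x powr - a + indicator {1..} x * x powr (- a - 1))"
    proof (rule AE_I2)
      fix x :: real
      consider "x < 0" | "0 \<le> x" "x < 1" | "1 \<le> x" by linarith
      then show "norm (indicator {0..} x * (x powr - a / (1 + x)))
        \<le> norm (indicator {0..1} x * x powr - a + indicator {1..} x * x powr (- a - 1))"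
      proof cases
        case 2
        then show ?thesis by (simp add: divide_le_eq mult_le_cancel_left1)
      next
        case 3
        then have "x powr - a / (1 + x) \<le> x powr - a / x" by (intro frac_le) auto
        also have "\<dots> = x powr (- a - 1)" using 3 by (simp add: powr_diff)
        finally show ?thesis using 3 by (auto simp: indicator_def)
      qed auto
    qed
  qed measurable
  have "integrable lborel (\<lambda>x. h (0 + (-1) * x))"
    by (rule lborel_integrable_real_affine[OF h]) simp
  then have "integrable lborel (\<lambda>x. h x + h (- x))"
    using h by simp
  \<comment> \<open>Both halves include the origin, which is harmless because
    \<open>0 powr - a\<close> is 0.\<close>
  moreover have "(\<lambda>x. h x + h (- x)) = (\<lambda>x. \<bar>x\<bar> powr - a / (1 + \<bar>x\<bar>))"
    by (auto simp: h_def indicator_def)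
  ultimately show ?thesis by simp
qed

text \<open>Off the real axis the kernel 1/|x - z| is at most a constant times 1/(1 + |x - p|), so a
  translate of the model majorant dominates.\<close>

lemma integrable_powr_div_norm:
  fixes a p :: real
  assumes "0 < a" "a < 1" "Im z \<noteq> 0"
  shows "integrable lborel (\<lambda>x. \<bar>x - p\<bar> powr - a / norm (of_real x - z))"
proof -
  \<comment> \<open>The constant comes from |x - p| <= |x - z| + |z - p|, with the fixed term 1 + |z
    - p| absorbed by means of |Im z| <= |x - z|.\<close>
  define M where "M = 1 + (1 + norm (z - of_real p)) / \<bar>Im z\<bar>"
  have "integrable lborel (\<lambda>x. \<bar>- p + 1 * x\<bar> powr - a / (1 + \<bar>- p + 1 * x\<bar>))"
    by (rule lborel_integrable_real_affine[OF integrable_powr_div_abs[OF assms(1,2)]]) simp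
  then have "integrable lborel (\<lambda>x. M * (\<bar>x - p\<bar> powr - a / (1 + \<bar>x - p\<bar>)))"
    by (intro integrable_mult_right) simp
  then show ?thesis
  proof (rule Bochner_Integration.integrable_bound)
    show "AE x in lborel. norm (\<bar>x - p\<bar> powr - a / norm (of_real x - z))
        \<le> norm (M * (\<bar>x - p\<bar> powr - a / (1 + \<bar>x - p\<bar>)))"
    proof (rule AE_I2)
      fix x :: real
      have d: "\<bar>Im z\<bar> \<le> norm (of_real x - z)" using abs_Im_le_cmod[of "of_real x - z"] by simp
      have "\<bar>x - p\<bar> \<le> norm (of_real x - z) + norm (z - of_real p)"
        using norm_triangle_ineq[of "of_real x - z" "z - of_real p"]
        by (simp flip: of_real_diff)
      moreover have "1 + norm (z - of_real p) \<le> (1 + norm (z - of_real p)) / \<bar>Im z\<bar> * norm (of_real x - z)"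
        using mult_left_mono[OF d, of "(1 + norm (z - of_real p)) / \<bar>Im z\<bar>"] assms(3) by simp
      ultimately have "1 + \<bar>x - p\<bar> \<le> M * norm (of_real x - z)"
        unfolding M_def by (simp add: algebra_simps)
      moreover have "norm (of_real x - z) > 0" using d assms(3) by linarith
      ultimately have "1 / norm (of_real x - z) \<le> M / (1 + \<bar>x - p\<bar>)"
        by (simp add: field_simps add_nonneg_pos)
      from mult_left_mono[OF this, of "\<bar>x - p\<bar> powr - a"]
      show "norm (\<bar>x - p\<bar> powr - a / norm (of_real x - z))
        \<le> norm (M * (\<bar>x - p\<bar> powr - a / (1 + \<bar>x - p\<bar>)))"
        by (simp add: abs_mult mult.commute M_def)
    qed
  qed measurable
qed

text \<open>The function is shifted upwards by i/(n+1), which moves the singular point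
  \<open>p\<close> below the real axis, and the half-disc formula is used with radius n. The bound
  survives the shift, so dominated convergence handles the diameter, while the negative exponents
  make the arc vanish.\<close>

lemma Cauchy_upper_half_plane:
  fixes g :: "complex \<Rightarrow> complex" and p a b K :: real
  assumes hol: "g holomorphic_on {w. 0 < Im w}"
    and cont: "continuous_on ({w. 0 \<le> Im w} - {of_real p}) g"
    and bound: "\<And>w. 0 \<le> Im w \<Longrightarrow> w \<noteq> of_real p \<Longrightarrow>
      norm (g w) \<le> K * (norm (w - of_real p) powr - a + norm (w - of_real p) powr - b)"
    and a: "0 < a" "a < 1" and b: "0 < b" "b < 1" and K: "0 \<le> K" and z: "Im z \<noteq> 0"
  shows "integrable lborel (\<lambda>x. g (of_real x) / (of_real x - z))"
    and "(\<integral>x. g (of_real x) / (of_real x - z) \<partial>lborel) = (if 0 < Im z then 2 * pi * \<i> * g z else 0)"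
proof -
  define e where "e n = 1 / real (Suc n)" for n
  \<comment> \<open>The shifted integrand truncated to the diameter; \<open>H\<close> below is its
    majorant for all n at once.\<close>
  define s where "s n x = indicator {- real n..real n} x *\<^sub>R
    (g (of_real x + \<i> * of_real (e n)) / (of_real x - z))" for n x
  define H where "H x = K * (\<bar>x - p\<bar> powr - a / norm (of_real x - z)
    + \<bar>x - p\<bar> powr - b / norm (of_real x - z))" for x
  define c where "c n = (if 0 < Im z then 2 * pi * \<i> * g (z + \<i> * of_real (e n)) else 0)" for n
  have e_pos: "e n > 0" for n by (simp add: e_def)
  have e_lim: "e \<longlonglongrightarrow> 0"
    unfolding e_def using LIMSEQ_inverse_real_of_nat by (simp add: inverse_eq_divide)
  have shift_lim: "(\<lambda>n. g (w + \<i> * of_real (e n))) \<longlonglongrightarrow> g w"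
    if "0 \<le> Im w" "w \<noteq> of_real p" for w
  proof (rule continuous_on_tendsto_compose[OF cont])
    show "(\<lambda>n. w + \<i> * of_real (e n)) \<longlonglongrightarrow> w"
      using tendsto_add[OF tendsto_const[of w] tendsto_mult[OF tendsto_const[of \<i>] tendsto_of_real[OF e_lim]]]
      by simp
    show "\<forall>\<^sub>F n in sequentially. w + \<i> * of_real (e n) \<in> {w. 0 \<le> Im w} - {of_real p}"
      using that e_pos by (auto simp: complex_eq_iff add_nonneg_eq_0_iff less_imp_le
          intro!: always_eventually less_imp_neq[symmetric])
  qed (use that in auto)
  have [measurable]: "(\<lambda>x. g (of_real x)) \<in> borel_measurable borel"
    by (rule borel_measurable_continuous_countable_exceptions[of "{p}"])
       (auto intro!: continuous_on_compose2[OF cont] continuous_intros)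
  have "continuous_on UNIV (\<lambda>x. g (of_real x + \<i> * of_real (e n)))" for n
    using e_pos[of n] by (intro continuous_on_compose2[OF cont] continuous_intros)
      (auto simp: complex_eq_iff)
  then have [measurable]: "(\<lambda>x. g (of_real x + \<i> * of_real (e n))) \<in> borel_measurable borel" for n
    by (rule borel_measurable_continuous_onI)
  have meas_s: "s n \<in> borel_measurable lborel" for n
    unfolding s_def by measurable
  have H_int: "integrable lborel H"
    unfolding H_def using integrable_powr_div_norm[OF a z] integrable_powr_div_norm[OF b z] by auto
  \<comment> \<open>The point \<open>p\<close> must be discarded: there \<open>powr\<close> returns
    0 and \<open>H\<close> vanishes, while the shifted function need not.\<close>
  have s_bound: "AE x in lborel. norm (s n x) \<le> H x" for n
    using AE_lborel_singleton[of p]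
  proof eventually_elim
    case (elim x)
    have "\<bar>x - p\<bar> \<le> norm (of_real x + \<i> * of_real (e n) - of_real p)"
      using abs_Re_le_cmod[of "of_real x + \<i> * of_real (e n) - of_real p"] by simp
    then have "norm (of_real x + \<i> * of_real (e n) - of_real p) powr - d \<le> \<bar>x - p\<bar> powr - d"
      if "d > 0" for d
      using elim that by (intro powr_mono2') auto
    then have "norm (g (of_real x + \<i> * of_real (e n))) \<le> K * (\<bar>x - p\<bar> powr - a + \<bar>x - p\<bar> powr - b)"
      using e_pos[of n] a b K
      by (intro order_trans[OF bound] mult_left_mono add_mono) (auto simp: complex_eq_iff less_imp_le)
    then have "norm (g (of_real x + \<i> * of_real (e n)) / (of_real x - z)) \<le> H x"
      unfolding H_def norm_divide add_divide_distrib[symmetric] times_divide_eq_right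
      by (rule divide_right_mono) simp
    moreover have "0 \<le> H x" unfolding H_def using K by simp
    ultimately show ?case unfolding s_def by (auto simp: indicator_def)
  qed
  have s_lim: "AE x in lborel. (\<lambda>n. s n x) \<longlonglongrightarrow> g (of_real x) / (of_real x - z)"
    using AE_lborel_singleton[of p]
  proof eventually_elim
    case (elim x)
    have "(\<lambda>n. g (of_real x + \<i> * of_real (e n)) / (of_real x - z)) \<longlonglongrightarrow> g (of_real x) / (of_real x - z)"
      using elim z by (intro tendsto_divide shift_lim tendsto_const) (auto simp: complex_eq_iff)
    moreover have "\<forall>\<^sub>F n in sequentially. \<bar>x\<bar> \<le> real n"
      using filterlim_real_sequentially by (simp add: filterlim_at_top)
    then have "\<forall>\<^sub>F n in sequentially. s n x = g (of_real x + \<i> * of_real (e n)) / (of_real x - z)"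
      by eventually_elim (auto simp: s_def indicator_def)
    ultimately show ?case by (simp add: filterlim_cong)
  qed
  have meas: "(\<lambda>x. g (of_real x) / (of_real x - z)) \<in> borel_measurable lborel"
    by measurable
  show "integrable lborel (\<lambda>x. g (of_real x) / (of_real x - z))"
    by (rule integrable_dominated_convergence[OF meas meas_s H_int s_lim s_bound])
  have int_lim: "(\<lambda>n. \<integral>x. s n x \<partial>lborel) \<longlonglongrightarrow> (\<integral>x. g (of_real x) / (of_real x - z) \<partial>lborel)"
    by (rule integral_dominated_convergence[OF meas meas_s H_int s_lim s_bound])
  define P where "P = \<bar>p\<bar>"
  define Z where "Z = norm z"
  \<comment> \<open>On the arc |w| = n the shifted point is at distance at least n - |p| from
    \<open>p\<close>.\<close>
  define B where "B n = K * ((real n - P) powr - a + (real n - P) powr - b)" for n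
  have "\<forall>\<^sub>F n in sequentially. P < real n" "\<forall>\<^sub>F n in sequentially. Z < real n"
    using filterlim_real_sequentially by (simp_all add: filterlim_at_top_dense)
  \<comment> \<open>If \<open>z\<close> lies below the axis, it must also lie below the strip on
    which the shifted function is holomorphic.\<close>
  moreover have "\<forall>\<^sub>F n in sequentially. e n < \<bar>Im z\<bar>"
    using order_tendstoD(2)[OF e_lim] z by simp
  ultimately have "\<forall>\<^sub>F n in sequentially.
      norm ((\<integral>x. s n x \<partial>lborel) - c n) \<le> B n / (real n - Z) * real n * pi"
  proof eventually_elim
    case (elim n)
    have "(\<lambda>w. g (w + \<i> * of_real (e n))) holomorphic_on {w. - e n < Im w}"
      by (intro holomorphic_on_compose_gen[OF _ hol, unfolded o_def] holomorphic_intros) auto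
    moreover have "norm (g (w + \<i> * of_real (e n))) \<le> B n" if w: "norm w = real n" "0 \<le> Im w" for w
    proof -
      let ?v = "w + \<i> * of_real (e n)"
      have "norm w \<le> norm ?v"
        using w(2) e_pos[of n] unfolding cmod_def
        by (simp add: power_mono)
      then have le: "real n - P \<le> norm (?v - of_real p)"
        using norm_triangle_ineq2[of ?v "of_real p"] w by (simp add: P_def)
      then have "norm (?v - of_real p) powr - d \<le> (real n - P) powr - d" if "d > 0" for d
        using elim that by (intro powr_mono2') auto
      moreover have "?v \<noteq> of_real p" using w e_pos[of n] by (auto simp: complex_eq_iff)
      ultimately show ?thesis
        unfolding B_def using w e_pos[of n] a b K
        by (intro order_trans[OF bound] mult_left_mono add_mono) (auto simp: less_imp_le)
    qed
    ultimately show ?case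
      using elim e_pos[of n] z
      unfolding s_def c_def Z_def
      by (intro Cauchy_upper_half_disc[where f = "\<lambda>w. g (w + \<i> * of_real (e n))" and e = "e n"]) auto
  qed
  moreover have "(\<lambda>n. B n / (real n - Z) * real n * pi) \<longlonglongrightarrow> 0"
  proof -
    have "((\<lambda>x. (x - P) powr - d) \<longlongrightarrow> 0) at_top" if "d > 0" for d
      using that by real_asymp
    moreover have "((\<lambda>x. x / (x - Z)) \<longlongrightarrow> 1) at_top"
      by real_asymp
    ultimately have "((\<lambda>x. K * ((x - P) powr - a + (x - P) powr - b) * (x / (x - Z)) * pi)
        \<longlongrightarrow> K * (0 + 0) * 1 * pi) at_top"
      using a b by (intro tendsto_intros) auto
    then have "((\<lambda>x. K * ((x - P) powr - a + (x - P) powr - b) / (x - Z) * x * pi) \<longlongrightarrow> 0) at_top"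
      by simp
    then show ?thesis
      unfolding B_def by (rule filterlim_compose[OF _ filterlim_real_sequentially])
  qed
  ultimately have "(\<lambda>n. (\<integral>x. s n x \<partial>lborel) - c n) \<longlonglongrightarrow> 0"
    by (rule Lim_null_comparison)
  moreover have "c \<longlonglongrightarrow> (if 0 < Im z then 2 * pi * \<i> * g z else 0)"
    unfolding c_def using z by (auto intro!: tendsto_intros shift_lim)
  ultimately have "(\<lambda>n. \<integral>x. s n x \<partial>lborel) \<longlonglongrightarrow> (if 0 < Im z then 2 * pi * \<i> * g z else 0)"
    using tendsto_add by fastforce
  with int_lim show "(\<integral>x. g (of_real x) / (of_real x - z) \<partial>lborel) = (if 0 < Im z then 2 * pi * \<i> * g z else 0)"
    by (rule LIMSEQ_unique)
qed

text \<open>For real x the conjugate of 1/(x - cnj z) is 1/(x - z). The formula at \<open>z\<close>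
  minus the conjugate of the vanishing one at \<open>cnj z\<close> therefore carries g - cnj g = 2i
  Im g over a single kernel.\<close>

lemma upper_half_plane_eq_integral_Im:
  fixes g :: "complex \<Rightarrow> complex" and p a b K :: real
  assumes "g holomorphic_on {w. 0 < Im w}"
    and "continuous_on ({w. 0 \<le> Im w} - {of_real p}) g"
    and "\<And>w. 0 \<le> Im w \<Longrightarrow> w \<noteq> of_real p \<Longrightarrow>
      norm (g w) \<le> K * (norm (w - of_real p) powr - a + norm (w - of_real p) powr - b)"
    and "0 < a" "a < 1" "0 < b" "b < 1" "0 \<le> K" and z: "0 < Im z"
  shows "integrable lborel (\<lambda>x. of_real (Im (g (of_real x))) / (of_real x - z))"
    and "g z = (\<integral>x. of_real (Im (g (of_real x))) / (of_real x - z) \<partial>lborel) / of_real pi"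
proof -
  let ?f = "\<lambda>z x. g (of_real x) / (of_real x - z)"
  note * = Cauchy_upper_half_plane[OF assms(1-8)]
  have 1: "integrable lborel (?f z)" "(\<integral>x. ?f z x \<partial>lborel) = 2 * pi * \<i> * g z"
    using *[of z] z by auto
  have 2: "integrable lborel (?f (cnj z))" "(\<integral>x. ?f (cnj z) x \<partial>lborel) = 0"
    using *[of "cnj z"] z by auto
  have eq: "of_real (Im (g (of_real x))) / (of_real x - z) = (?f z x - cnj (?f (cnj z) x)) / (2 * \<i>)" for x
  proof -
    have 1: "g (of_real x) - cnj (g (of_real x)) = of_real (Im (g (of_real x))) * (2 * \<i>)"
      by (simp add: complex_eq_iff)
    have 2: "?f z x - cnj (?f (cnj z) x) = (g (of_real x) - cnj (g (of_real x))) / (of_real x - z)"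
      by (simp add: diff_divide_distrib)
    have 3: "A * (2 * \<i>) / B / (2 * \<i>) = A / B" for A B :: complex
      by (cases "B = 0") (simp_all add: field_simps)
    show ?thesis unfolding 1 2 3 ..
  qed
  show "integrable lborel (\<lambda>x. of_real (Im (g (of_real x))) / (of_real x - z))"
    unfolding eq using 1 2 by (intro integrable_divide Bochner_Integration.integrable_diff integrable_cnj) auto
  have "(\<integral>x. of_real (Im (g (of_real x))) / (of_real x - z) \<partial>lborel)
      = ((\<integral>x. ?f z x \<partial>lborel) - (\<integral>x. cnj (?f (cnj z) x) \<partial>lborel)) / (2 * \<i>)"
    unfolding eq by (subst Bochner_Integration.integral_divide_zero,
        subst Bochner_Integration.integral_diff[OF 1(1) integrable_cnj[OF 2(1)]]) (rule refl)
  also have "\<dots> = of_real pi * g z"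
    unfolding Bochner_Integration.integral_cnj 1(2) 2(2) by (simp add: field_simps)
  finally show "g z = (\<integral>x. of_real (Im (g (of_real x))) / (of_real x - z) \<partial>lborel) / of_real pi"
    by simp
qed

subsection \<open>Functions on the slit plane\<close>

lemma slit_plane_iff: "z \<in> slit_plane \<longleftrightarrow> Im z \<noteq> 0 \<or> Re z < 1"
  by (auto simp: slit_plane_def complex_eq_iff image_iff)

lemma slit_plane_eq: "slit_plane = - {z. Im z = 0 \<and> 1 \<le> Re z}"
  by (auto simp: slit_plane_iff not_le)

lemma open_slit_plane: "open slit_plane"
proof -
  have "{z. Im z = 0 \<and> 1 \<le> Re z} = {z. Im z = 0} \<inter> {z. 1 \<le> Re z}" by auto
  then show ?thesis unfolding slit_plane_eq
    by (simp add: closed_Collect_eq closed_Int closed_halfspace_Re_ge open_Compl continuous_intros)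
qed

text \<open>This makes the slit plane star-shaped about 0, hence connected, and also keeps 1 - t z
  from vanishing.\<close>

lemma scaleR_slit_plane:
  assumes "z \<in> slit_plane" "0 \<le> t" "t \<le> 1"
  shows "of_real t * z \<in> slit_plane"
  using assms mult_left_le_one_le[of "Re z" t]
  by (cases "t = 0"; cases "Re z < 0"; auto simp: slit_plane_iff mult_pos_neg less_imp_le
      intro: le_less_trans less_trans[of _ 0])

lemma connected_slit_plane: "connected slit_plane"
proof (rule starlike_imp_connected)
  have "closed_segment 0 z \<subseteq> slit_plane" if "z \<in> slit_plane" for z
    using scaleR_slit_plane[OF that] by (auto simp: closed_segment_def scaleR_conv_of_real)
  moreover have "0 \<in> slit_plane" by (simp add: slit_plane_iff)
  ultimately show "starlike slit_plane" unfolding starlike_def by blast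
qed

text \<open>The right part Re w > 1 and the slit plane are relatively open and cover the punctured
  closed half-plane. They overlap there only at points with Im w > 0, where both functions
  agree.\<close>

lemma continuous_on_glue_upper_half_plane:
  fixes f g :: "complex \<Rightarrow> complex"
  assumes f: "continuous_on slit_plane f"
    and g: "continuous_on ({w. 0 < Im w} \<union> of_real ` {1<..}) g"
    and eq: "\<And>w. 0 < Im w \<Longrightarrow> g w = f w"
  shows "continuous_on ({w. 0 \<le> Im w} - {1}) (\<lambda>w. if 1 < Re w then g w else f w)"
proof -
  let ?S = "{w. 0 \<le> Im w} - {1}" and ?G = "{w. 1 < Re w}"
  have U: "?S \<inter> ?G \<union> ?S \<inter> slit_plane = ?S"
    by (auto simp: slit_plane_iff complex_eq_iff not_less)
  have "continuous_on (?S \<inter> ?G \<union> ?S \<inter> slit_plane) (\<lambda>w. if 1 < Re w then g w else f w)"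
  proof (rule continuous_on_cases_local_open)
    show "openin (top_of_set (?S \<inter> ?G \<union> ?S \<inter> slit_plane)) (?S \<inter> ?G)"
      unfolding U by (rule openin_open_Int[OF open_halfspace_Re_gt])
    show "openin (top_of_set (?S \<inter> ?G \<union> ?S \<inter> slit_plane)) (?S \<inter> slit_plane)"
      unfolding U by (rule openin_open_Int[OF open_slit_plane])
    have "?S \<inter> ?G \<subseteq> {w. 0 < Im w} \<union> of_real ` {1<..}"
      by (auto simp: image_iff complex_eq_iff less_le)
    then show "continuous_on (?S \<inter> ?G) g" by (rule continuous_on_subset[OF g])
    show "continuous_on (?S \<inter> slit_plane) f" by (rule continuous_on_subset[OF f]) auto
    show "g w = f w" if "w \<in> ?S \<inter> ?G \<and> \<not> 1 < Re w \<or> w \<in> ?S \<inter> slit_plane \<and> 1 < Re w" for w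
      using that by (intro eq) (auto simp: slit_plane_iff less_le)
  qed
  then show ?thesis unfolding U .
qed

text \<open>Away from infinity and from 1 there remains a compact set, on which the quotient by the
  positive comparison function is bounded. The growth hypotheses concern the open half-plane only;
  continuity carries the bound to the real line.\<close>

lemma closed_upper_half_plane_bound:
  fixes g :: "complex \<Rightarrow> complex" and a b :: real
  assumes cont: "continuous_on ({w. 0 \<le> Im w} - {1}) g"
    and far: "\<And>w. 0 < Im w \<Longrightarrow> R \<le> norm w \<Longrightarrow> norm (g w) \<le> c * norm (w - 1) powr - b"
    and near: "\<And>w. 0 < Im w \<Longrightarrow> norm (w - 1) < \<delta> \<Longrightarrow> norm (g w) \<le> d * norm (w - 1) powr - a"
    and \<delta>: "0 < \<delta>"
  obtains K where "0 \<le> K" "\<And>w. 0 \<le> Im w \<Longrightarrow> w \<noteq> 1 \<Longrightarrow>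
      norm (g w) \<le> K * (norm (w - 1) powr - a + norm (w - 1) powr - b)"
proof -
  let ?h = "\<lambda>w. norm (w - 1) powr - a + norm (w - 1) powr - b"
  define C where "C = {w. 0 \<le> Im w} \<inter> cball 0 R - ball (1::complex) \<delta>"
  have "compact C" unfolding C_def
    by (intro compact_diff closed_Int_compact closed_halfspace_Im_ge compact_cball open_ball)
  have C: "w \<noteq> 1" "0 \<le> Im w" if "w \<in> C" for w using that \<delta> by (auto simp: C_def)
  have "continuous_on C (\<lambda>w. norm (g w) / ?h w)"
    using C by (intro continuous_intros continuous_on_subset[OF cont])
      (auto simp: add_nonneg_eq_0_iff)
  then have "bounded ((\<lambda>w. norm (g w) / ?h w) ` C)"
    using \<open>compact C\<close> by (intro compact_imp_bounded compact_continuous_image)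
  then obtain M where M: "\<And>w. w \<in> C \<Longrightarrow> norm (g w) / ?h w \<le> M"
    unfolding bounded_iff by (auto dest: abs_le_D1)
  define K where "K = \<bar>M\<bar> + \<bar>c\<bar> + \<bar>d\<bar>"
  have K: "0 \<le> K" by (simp add: K_def)
  have open_bound: "norm (g w) \<le> K * ?h w" if w: "0 < Im w" for w
  proof -
    have h: "0 < ?h w" using w by (intro add_pos_pos) (auto simp: complex_eq_iff)
    have "norm (g w) \<le> \<bar>M\<bar> * ?h w \<or> norm (g w) \<le> \<bar>c\<bar> * ?h w \<or> norm (g w) \<le> \<bar>d\<bar> * ?h w"
    proof -
      consider "R \<le> norm w" | "norm (w - 1) < \<delta>" | "w \<in> C"
        using w by (auto simp: C_def dist_norm norm_minus_commute not_less) linarith+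
      then show ?thesis
      proof cases
        case 1
        have "norm (g w) \<le> c * norm (w - 1) powr - b" using far[OF w 1] .
        also have "\<dots> \<le> \<bar>c\<bar> * ?h w" by (intro mult_mono) auto
        finally show ?thesis by blast
      next
        case 2
        have "norm (g w) \<le> d * norm (w - 1) powr - a" using near[OF w 2] .
        also have "\<dots> \<le> \<bar>d\<bar> * ?h w" by (intro mult_mono) auto
        finally show ?thesis by blast
      next
        case 3
        have "norm (g w) \<le> M * ?h w" using M[OF 3] h by (simp add: divide_le_eq)
        also have "\<dots> \<le> \<bar>M\<bar> * ?h w" using h by (intro mult_right_mono) auto
        finally show ?thesis by blast
      qed
    qed
    moreover have "\<bar>M\<bar> * ?h w \<le> K * ?h w" "\<bar>c\<bar> * ?h w \<le> K * ?h w" "\<bar>d\<bar> * ?h w \<le> K * ?h w"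
      using h by (auto intro!: mult_right_mono simp: K_def)
    ultimately show ?thesis by linarith
  qed
  have "norm (g w) \<le> K * ?h w" if w: "0 \<le> Im w" "w \<noteq> 1" for w
  proof (rule tendsto_le)
    \<comment> \<open>A point of the closed half-plane is approached vertically from above, where
      the bound is already known.\<close>
    let ?v = "\<lambda>t::real. w + \<i> * of_real t"
    have v: "(?v \<longlongrightarrow> w) (at_right 0)"
      by (auto intro!: tendsto_eq_intros)
    have up: "\<forall>\<^sub>F t in at_right 0. 0 < Im (?v t)"
      using eventually_at_right_less[of "0::real"] by eventually_elim (use w in simp)
    show "((\<lambda>t. norm (g (?v t))) \<longlongrightarrow> norm (g w)) (at_right 0)"
      using up w
      by (intro tendsto_norm continuous_on_tendsto_compose[OF cont v])
         (auto elim!: eventually_mono simp: complex_eq_iff)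
    show "((\<lambda>t. K * ?h (?v t)) \<longlongrightarrow> K * ?h w) (at_right 0)"
      using w by (intro tendsto_intros v) auto
    show "\<forall>\<^sub>F t in at_right 0. norm (g (?v t)) \<le> K * ?h (?v t)"
      using up by eventually_elim (rule open_bound)
  qed simp
  with K that show thesis by blast
qed

subsection \<open>Measures on the unit interval\<close>

text \<open>The change of variables x = 1/t maps (0,1) onto (1, infinity), and 1/t^2 is the absolute
  value of its derivative.\<close>

lemma set_integral_substitution_inverse:
  fixes f :: "real \<Rightarrow> 'a::euclidean_space"
  assumes f: "set_integrable lborel {1<..} f"
  shows "set_integrable lborel {0<..<1} (\<lambda>t. (1 / t\<^sup>2) *\<^sub>R f (1 / t))"
    and "(LINT t:{0<..<1}|lborel. (1 / t\<^sup>2) *\<^sub>R f (1 / t)) = (LINT x:{1<..}|lborel. f x)"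
proof -
  have [measurable]: "(\<lambda>x. indicator {1<..} x *\<^sub>R f x) \<in> borel_measurable borel"
    using borel_measurable_integrable[OF f[unfolded set_integrable_def]] by simp
  \<comment> \<open>The substitution rule gives integrability for the completed measure; Borel
    measurability is what brings it back to \<open>lborel\<close>.\<close>
  have "(\<lambda>t. indicator {0<..<1} t *\<^sub>R (1 / t\<^sup>2) *\<^sub>R (indicator {1<..} (1 / t) *\<^sub>R f (1 / t))) \<in> borel_measurable borel"
    by measurable
  also have "(\<lambda>t. indicator {0<..<1} t *\<^sub>R (1 / t\<^sup>2) *\<^sub>R (indicator {1<..} (1 / t) *\<^sub>R f (1 / t)))
      = (\<lambda>t. indicator {0<..<1} t *\<^sub>R ((1 / t\<^sup>2) *\<^sub>R f (1 / t)))"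
    by (auto simp: indicator_def fun_eq_iff)
  finally have m: "(\<lambda>t. indicator {0<..<1} t *\<^sub>R ((1 / t\<^sup>2) *\<^sub>R f (1 / t))) \<in> borel_measurable lborel"
    by simp
  have img: "(\<lambda>t. 1 / t) ` {0<..<1} = {1::real<..}"
  proof (intro equalityI subsetI)
    show "x \<in> (\<lambda>t. 1 / t) ` {0<..<1}" if "x \<in> {1<..}" for x :: real
      using that by (intro image_eqI[of _ _ "1 / x"]) auto
  qed auto
  have der: "((\<lambda>t. 1 / t) has_field_derivative - (1 / t\<^sup>2)) (at t within {0<..<1})"
    if "t \<in> {0<..<1}" for t :: real
    using that by (auto intro!: derivative_eq_intros simp: power2_eq_square)
  have inj: "inj_on (\<lambda>t. 1 / t) {0<..<1::real}" by (auto intro: inj_onI)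
  have "f absolutely_integrable_on {1<..}"
    using f unfolding set_integrable_def by (subst integrable_completion) simp_all
  then have *: "(\<lambda>t. \<bar>- (1 / t\<^sup>2)\<bar> *\<^sub>R f (1 / t)) absolutely_integrable_on {0<..<1}"
    "integral {0<..<1} (\<lambda>t. \<bar>- (1 / t\<^sup>2)\<bar> *\<^sub>R f (1 / t)) = integral {1<..} f"
    using has_absolute_integral_change_of_variables_real[OF _ der inj, of f "integral {1<..} f"]
    unfolding img by auto
  show int: "set_integrable lborel {0<..<1} (\<lambda>t. (1 / t\<^sup>2) *\<^sub>R f (1 / t))"
    using *(1) m unfolding set_integrable_def by (subst (asm) integrable_completion) simp_all
  show "(LINT t:{0<..<1}|lborel. (1 / t\<^sup>2) *\<^sub>R f (1 / t)) = (LINT x:{1<..}|lborel. f x)"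
    using *(2) by (simp add: set_borel_integral_eq_integral(2)[OF int] set_borel_integral_eq_integral(2)[OF f])
qed

text \<open>Realising the measure as an image of one with a Lebesgue density yields both the
  decomposition on sets and the integral formula by transport; the total mass condition makes it a
  probability.\<close>

lemma unit_interval_measure_exists:
  fixes w :: "real \<Rightarrow> real"
  assumes a0: "0 \<le> a0" and w_nonneg: "\<And>t. t \<in> {0<..<1} \<Longrightarrow> 0 \<le> w t"
    and w: "set_integrable lborel {0<..<1} w"
    and total: "a0 + (LINT t:{0<..<1}|lborel. w t) = 1"
  obtains \<mu> where "borel_prob_unit_interval \<mu>" "has_decomposition \<mu> a0 0 w"
    "\<And>f :: real \<Rightarrow> complex. continuous_on {0..1} f \<Longrightarrow>
      (\<integral>t. f t \<partial>\<mu>) = of_real a0 * f 0 + (LINT t:{0<..<1}|lborel. of_real (w t) * f t)"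
proof -
  \<comment> \<open>The atom at \<open>0\<close> is the image under \<open>\<phi>\<close> of mass spread over \<open>[1, 2)\<close>.\<close>
  define k where "k t = indicator {0<..<1} t * w t + a0 * indicator {1..<2} t" for t :: real
  define \<phi> where "\<phi> t = indicator {0<..<1} t * t" for t :: real
  define N where "N = density lborel (\<lambda>t. ennreal (k t))"
  define \<mu> where "\<mu> = distr N (restrict_space borel {0..1}) \<phi>"
  have [measurable]: "(\<lambda>t. indicator {0<..<1} t * w t) \<in> borel_measurable borel"
    using borel_measurable_integrable[OF w[unfolded set_integrable_def]] by simp
  have [measurable]: "k \<in> borel_measurable borel" unfolding k_def by measurable
  have [measurable]: "\<phi> \<in> borel_measurable borel" unfolding \<phi>_def by measurable
  have k_nonneg: "0 \<le> k t" for t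
    using a0 w_nonneg[of t] by (auto simp: k_def indicator_def)
  have \<phi>: "\<phi> \<in> N \<rightarrow>\<^sub>M restrict_space borel {0..1}"
    by (rule measurable_restrict_space2) (auto simp: \<phi>_def N_def indicator_def)
  have sets_\<mu>: "sets \<mu> = sets (restrict_space borel {0..1})" by (simp add: \<mu>_def)
  have space_\<mu>: "space \<mu> = {0..1}" by (simp add: \<mu>_def space_restrict_space)
  have em: "emeasure \<mu> A = ennreal a0 * indicator A 0 + ennreal 0 * indicator A 1
      + (\<integral>\<^sup>+t\<in>A \<inter> {0<..<1}. ennreal (w t) \<partial>lborel)" if A: "A \<in> sets \<mu>" for A
  proof -
    have [measurable]: "A \<in> sets borel"
      using A unfolding sets_\<mu> by (auto simp: sets_restrict_space)
    have pre: "\<phi> -` A \<inter> space N \<in> sets lborel"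
      using measurable_sets[OF \<phi>, of A] A by (simp add: sets_\<mu> N_def)
    have "emeasure \<mu> A = emeasure N (\<phi> -` A \<inter> space N)"
      unfolding \<mu>_def by (rule emeasure_distr[OF \<phi>]) (use A in \<open>simp add: sets_\<mu>\<close>)
    also have "\<dots> = (\<integral>\<^sup>+t. ennreal (k t) * indicator (\<phi> -` A \<inter> space N) t \<partial>lborel)"
      using pre unfolding N_def by (subst emeasure_density) auto
    \<comment> \<open>The map \<open>\<phi>\<close> is the identity on (0,1) and 0 elsewhere, and
      \<open>k\<close> vanishes outside (0,2), so only [1,2) feeds the atom.\<close>
    also have "\<dots> = (\<integral>\<^sup>+t. ennreal a0 * indicator A 0 * indicator {1..<2} t
        + ennreal (indicator {0<..<1} t * w t) * indicator A t \<partial>lborel)"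
      by (intro nn_integral_cong) (auto simp: k_def \<phi>_def N_def indicator_def)
    also have "\<dots> = ennreal a0 * indicator A 0 * emeasure lborel {1..<2::real}
        + (\<integral>\<^sup>+t. ennreal (indicator {0<..<1} t * w t) * indicator A t \<partial>lborel)"
      by (subst nn_integral_add) (auto simp: nn_integral_cmult_indicator)
    also have "(\<integral>\<^sup>+t. ennreal (indicator {0<..<1} t * w t) * indicator A t \<partial>lborel)
        = (\<integral>\<^sup>+t\<in>A \<inter> {0<..<1}. ennreal (w t) \<partial>lborel)"
      by (intro nn_integral_cong) (auto simp: indicator_def)
    finally show ?thesis by simp
  qed
  have dec: "has_decomposition \<mu> a0 0 w"
    unfolding has_decomposition_def set_borel_measurable_def using a0 w_nonneg em sets_\<mu> by auto
  have "(\<integral>\<^sup>+t\<in>{0..1} \<inter> {0<..<1}. ennreal (w t) \<partial>lborel)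
      = (\<integral>\<^sup>+t. ennreal (indicator {0<..<1} t * w t) \<partial>lborel)"
    by (intro nn_integral_cong) (auto simp: indicator_def)
  also have "\<dots> = ennreal (LINT t:{0<..<1}|lborel. w t)"
    unfolding set_lebesgue_integral_def
    using w w_nonneg unfolding set_integrable_def
    by (subst nn_integral_eq_integral) (auto simp: indicator_def)
  finally have "emeasure \<mu> (space \<mu>) = ennreal (a0 + (LINT t:{0<..<1}|lborel. w t))"
    using em[OF sets.top] a0 w_nonneg
    by (simp add: space_\<mu> ennreal_plus set_lebesgue_integral_def integral_nonneg_AE indicator_def)
  then have "prob_space \<mu>" unfolding total by (intro prob_spaceI) simp
  then have prob: "borel_prob_unit_interval \<mu>"
    unfolding borel_prob_unit_interval_def using sets_\<mu> by simp
  have "(\<integral>t. f t \<partial>\<mu>) = of_real a0 * f 0 + (LINT t:{0<..<1}|lborel. of_real (w t) * f t)"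
    if f: "continuous_on {0..1} f" for f :: "real \<Rightarrow> complex"
  proof -
    have fm: "f \<in> borel_measurable (restrict_space borel {0..1})"
      by (rule borel_measurable_continuous_on_restrict[OF f])
    have "(\<lambda>t. f (\<phi> t)) \<in> borel_measurable N"
      using measurable_comp[OF \<phi> fm] by (simp add: o_def)
    then have [measurable]: "(\<lambda>t. f (\<phi> t)) \<in> borel_measurable borel" by (simp add: N_def)
    obtain B where B: "\<And>t. t \<in> {0..1} \<Longrightarrow> norm (f t) \<le> B"
      using compact_imp_bounded[OF compact_continuous_image[OF f compact_Icc]]
      unfolding bounded_iff by blast
    have B': "norm (f (\<phi> t)) \<le> B" for t by (rule B) (auto simp: \<phi>_def indicator_def)
    have w': "integrable lborel (\<lambda>t. of_real (indicator {0<..<1} t * w t) * f (\<phi> t))"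
    proof (rule Bochner_Integration.integrable_bound)
      show "integrable lborel (\<lambda>t. B * (indicator {0<..<1} t * w t))"
        using w unfolding set_integrable_def by (intro integrable_mult_right) simp
      show "AE t in lborel. norm (of_real (indicator {0<..<1} t * w t) * f (\<phi> t))
          \<le> norm (B * (indicator {0<..<1} t * w t))"
        using B' by (intro AE_I2) (auto simp: norm_mult abs_mult mult.commute intro!: mult_right_mono
            order_trans[OF B' abs_ge_self])
    qed measurable
    have "(\<integral>t. f t \<partial>\<mu>) = (\<integral>t. f (\<phi> t) \<partial>N)"
      unfolding \<mu>_def by (rule integral_distr[OF \<phi> fm])
    also have "\<dots> = (\<integral>t. k t *\<^sub>R f (\<phi> t) \<partial>lborel)"
      unfolding N_def using k_nonneg by (intro integral_density) auto
    also have "\<dots> = (\<integral>t. indicator {1..<2} t *\<^sub>R (of_real a0 * f 0)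
        + of_real (indicator {0<..<1} t * w t) * f (\<phi> t) \<partial>lborel)"
      by (intro Bochner_Integration.integral_cong)
         (auto simp: k_def \<phi>_def indicator_def scaleR_conv_of_real)
    also have "\<dots> = of_real a0 * f 0
        + (\<integral>t. of_real (indicator {0<..<1} t * w t) * f (\<phi> t) \<partial>lborel)"
      using w' by (subst Bochner_Integration.integral_add) auto
    also have "(\<integral>t. of_real (indicator {0<..<1} t * w t) * f (\<phi> t) \<partial>lborel)
        = (LINT t:{0<..<1}|lborel. of_real (w t) * f t)"
      unfolding set_lebesgue_integral_def
      by (intro Bochner_Integration.integral_cong) (auto simp: \<phi>_def indicator_def)
    finally show ?thesis .
  qed
  with prob dec that show thesis by blast
qed

subsection \<open>The boundary integral formula\<close>

text \<open>Division by w lowers the growth exponent by one, which makes it negative since \<alpha>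
  < 1. For |w| >= 2 the inequality |w - 1| <= 2|w| allows the decay to be measured from 1.\<close>

lemma quotient_bound_far:
  fixes f :: "complex \<Rightarrow> complex" and \<alpha> :: real
  assumes \<alpha>: "\<alpha> < 1"
    and f: "f \<in> O[inf at_infinity (principal A)](\<lambda>z. of_real (norm z powr \<alpha>))"
  obtains b c R where "0 < b" "b < 1" "\<And>w. w \<in> A \<Longrightarrow> R \<le> norm w \<Longrightarrow>
      norm ((f w - 1) / w) \<le> c * norm (w - 1) powr - b"
proof -
  from f obtain c where c: "c > 0"
    and "\<forall>\<^sub>F w in inf at_infinity (principal A). norm (f w) \<le> c * norm (complex_of_real (norm w powr \<alpha>))"
    by (auto elim: landau_o.bigE)
  then have "\<forall>\<^sub>F w in at_infinity. w \<in> A \<longrightarrow> norm (f w) \<le> c * norm w powr \<alpha>"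
    by (simp add: eventually_inf_principal)
  then obtain R where R: "\<And>w. R \<le> norm w \<Longrightarrow> w \<in> A \<Longrightarrow> norm (f w) \<le> c * norm w powr \<alpha>"
    unfolding eventually_at_infinity by blast
  \<comment> \<open>Raising the growth exponent to at least 1/2 keeps \<open>b\<close> strictly
    between 0 and 1, whatever the sign of \<alpha>.\<close>
  define b where "b = 1 - max \<alpha> (1/2)"
  have b: "0 < b" "b < 1" "\<alpha> \<le> 1 - b" using \<alpha> by (auto simp: b_def)
  \<comment> \<open>The term c + 1 absorbs the subtracted 1 into |w|^(1-b) >= 1; the factor 2 bounds
    2^b.\<close>
  have "norm ((f w - 1) / w) \<le> (2 * (c + 1)) * norm (w - 1) powr - b"
    if w: "w \<in> A" "max R 2 \<le> norm w" for w
  proof -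
    let ?r = "norm w"
    have r: "R \<le> ?r" "2 \<le> ?r" using w by auto
    have "w \<noteq> 1" using r by auto
    have "norm (f w - 1) \<le> norm (f w) + 1" using norm_triangle_ineq4[of "f w" 1] by simp
    also have "\<dots> \<le> c * ?r powr (1 - b) + ?r powr (1 - b)"
      using R[OF r(1) w(1)] r b c ge_one_powr_ge_zero[of ?r "1 - b"]
      by (intro add_mono order_trans[OF R[OF r(1) w(1)]] mult_left_mono powr_mono) auto
    finally have "norm (f w - 1) / ?r \<le> (c * ?r powr (1 - b) + ?r powr (1 - b)) / ?r"
      by (rule divide_right_mono) simp
    then have "norm ((f w - 1) / w) \<le> (c + 1) * (?r powr (1 - b) / ?r)"
      by (simp add: norm_divide add_divide_distrib distrib_right)
    moreover have "?r powr (1 - b) / ?r \<le> norm (w - 1) powr - b * 2"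
    proof -
      have "?r powr (1 - b) / ?r = ?r powr - b"
        using r by (simp add: powr_diff powr_minus field_simps)
      also have "\<dots> \<le> (norm (w - 1) / 2) powr - b"
        using r b \<open>w \<noteq> 1\<close> norm_triangle_ineq4[of w 1] by (intro powr_mono2') auto
      also have "\<dots> = norm (w - 1) powr - b * 2 powr b"
        by (simp add: powr_divide powr_minus field_simps)
      also have "\<dots> \<le> norm (w - 1) powr - b * 2"
        using b powr_mono[of b 1 2] by (intro mult_left_mono) auto
      finally show ?thesis .
    qed
    ultimately have "norm ((f w - 1) / w) \<le> (c + 1) * (norm (w - 1) powr - b * 2)"
      using c by (elim order_trans) (intro mult_left_mono, auto)
    then show ?thesis by (simp add: algebra_simps)
  qed
  with b(1,2) show thesis using that[of b "max R 2" "2 * (c + 1)"] by auto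
qed

text \<open>Within distance 1/2 of 1 the denominator has modulus at least 1/2, and a larger exponent
  only weakens the bound, so \<alpha> may be raised to a positive number below 1.\<close>

lemma quotient_bound_near:
  fixes f :: "complex \<Rightarrow> complex" and \<alpha> :: real
  assumes \<alpha>: "\<alpha> < 1"
    and f: "f \<in> O[at 1 within A](\<lambda>z. of_real (norm (z - 1) powr - \<alpha>))" and A: "1 \<notin> A"
  obtains a c \<delta> where "0 < a" "a < 1" "0 < \<delta>" "\<And>w. w \<in> A \<Longrightarrow> norm (w - 1) < \<delta> \<Longrightarrow>
      norm ((f w - 1) / w) \<le> c * norm (w - 1) powr - a"
proof -
  from f obtain c where c: "c > 0"
    and "\<forall>\<^sub>F w in at 1 within A. norm (f w) \<le> c * norm (complex_of_real (norm (w - 1) powr - \<alpha>))"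
    by (auto elim: landau_o.bigE)
  then obtain \<delta> where \<delta>: "0 < \<delta>" "\<And>w. w \<in> A \<Longrightarrow> w \<noteq> 1 \<Longrightarrow> norm (w - 1) < \<delta> \<Longrightarrow>
      norm (f w) \<le> c * norm (w - 1) powr - \<alpha>"
    unfolding eventually_at by (auto simp: dist_norm)
  define a where "a = max \<alpha> (1/2)"
  have a: "0 < a" "a < 1" "\<alpha> \<le> a" using \<alpha> by (auto simp: a_def)
  have "norm ((f w - 1) / w) \<le> (2 * (c + 1)) * norm (w - 1) powr - a"
    if w: "w \<in> A" "norm (w - 1) < min \<delta> (1/2)" for w
  proof -
    let ?r = "norm (w - 1)"
    have "w \<noteq> 1" using w A by auto
    then have r: "0 < ?r" "?r < 1/2" using w by auto
    have w_norm: "1/2 \<le> norm w" using norm_triangle_ineq2[of 1 w] r by (simp add: norm_minus_commute)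
    have pow: "?r powr - \<alpha> \<le> ?r powr - a" "1 \<le> ?r powr - a"
      using r a powr_mono'[of "- a" "- \<alpha>" ?r] powr_mono'[of "- a" 0 ?r] by auto
    have "norm (f w - 1) \<le> norm (f w) + 1" using norm_triangle_ineq4[of "f w" 1] by simp
    also have "\<dots> \<le> c * ?r powr - a + ?r powr - a"
      using w \<open>w \<noteq> 1\<close> c pow
      by (intro add_mono order_trans[OF \<delta>(2)] mult_left_mono) auto
    finally have "norm (f w - 1) / norm w \<le> ((c + 1) * ?r powr - a) / (1/2)"
      using w_norm c by (intro frac_le) (auto simp: algebra_simps)
    then show ?thesis by (simp add: norm_divide algebra_simps)
  qed
  with a(1,2) \<delta>(1) show thesis using that[of a "min \<delta> (1/2)" "2 * (c + 1)"] by auto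
qed

section \<open>The quotient (F - 1)/z, its boundary values and the upper half-plane formula\<close>

locale slit_function =
  fixes F Fp :: "complex \<Rightarrow> complex"
  assumes analytic: "F analytic_on slit_plane"
    and F_0: "F 0 = 1"
    and extends: "extends_across_slit F Fp"
    and F_real: "\<And>x::real. x < 1 \<Longrightarrow> F (of_real x) \<in> \<real>"
    and growth_far: "\<exists>\<alpha>::real. \<alpha> < 1 \<and>
           F \<in> O[inf at_infinity (principal upper_half_plane)](\<lambda>z. complex_of_real (norm z powr \<alpha>))"
    and growth_near: "\<exists>\<alpha>::real. \<alpha> < 1 \<and>
           F \<in> O[at 1 within upper_half_plane](\<lambda>z. complex_of_real (norm (z - 1) powr (- \<alpha>)))"
begin

text \<open>The value at 0 fills the singularity that F(0) = 1 makes removable, so \<open>q\<close>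
  is holomorphic on the whole slit plane.\<close>

definition q :: "complex \<Rightarrow> complex" where
  "q w = (if w = 0 then deriv F 0 else (F w - 1) / w)"

text \<open>The boundary values of \<open>q\<close> from the upper half-plane; junk below \<open>(1, \<infinity>)\<close>.\<close>

definition g :: "complex \<Rightarrow> complex" where
  "g w = (if 1 < Re w then (Fp w - 1) / w else q w)"

definition v :: "real \<Rightarrow> real" where
  "v x = Im (Fp (of_real x))"

lemma holomorphic: "F holomorphic_on slit_plane"
  by (rule analytic_imp_holomorphic[OF analytic])

lemma F_eq: "w \<in> slit_plane \<Longrightarrow> F w = 1 + w * q w"
  by (auto simp: q_def F_0)

lemma Fp_eq: "0 < Im w \<Longrightarrow> Fp w = F w"
  using extends by (auto simp: extends_across_slit_def upper_half_plane_def)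

lemma continuous_on_Fp: "continuous_on ({w. 0 < Im w} \<union> of_real ` {1<..}) Fp"
  using extends unfolding extends_across_slit_def upper_half_plane_def
  by (meson analytic_imp_holomorphic continuous_on_subset holomorphic_on_imp_continuous_on)

lemma continuous_on_v: "continuous_on {1<..} v"
  unfolding v_def
  by (intro continuous_intros continuous_on_compose2[OF continuous_on_Fp]) auto

lemma q_holomorphic: "q holomorphic_on slit_plane"
  using pole_lemma[OF holomorphic, of 0] interior_open[OF open_slit_plane]
  unfolding q_def[abs_def] F_0 diff_zero by (simp add: slit_plane_iff)

lemma g_upper: "0 < Im w \<Longrightarrow> g w = q w"
  by (auto simp: g_def q_def Fp_eq)

lemma g_holomorphic: "g holomorphic_on {w. 0 < Im w}"
  by (rule holomorphic_transform[OF holomorphic_on_subset[OF q_holomorphic]])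
     (auto simp: slit_plane_iff g_upper)

lemma g_continuous: "continuous_on ({w. 0 \<le> Im w} - {1}) g"
  unfolding g_def[abs_def]
proof (rule continuous_on_glue_upper_half_plane)
  show "continuous_on slit_plane q"
    by (rule holomorphic_on_imp_continuous_on[OF q_holomorphic])
  show "continuous_on ({w. 0 < Im w} \<union> of_real ` {1<..}) (\<lambda>w. (Fp w - 1) / w)"
    by (intro continuous_intros continuous_on_Fp) auto
qed (auto simp: q_def Fp_eq)

text \<open>This is the estimate required by Cauchy's formula on the half-plane with p = 1: one
  exponent stems from the growth at 1, the other from the growth at infinity.\<close>

lemma g_bound:
  obtains a b K where "0 < a" "a < 1" "0 < b" "b < 1" "0 \<le> K"
    "\<And>w. 0 \<le> Im w \<Longrightarrow> w \<noteq> 1 \<Longrightarrow> norm (g w) \<le> K * (norm (w - 1) powr - a + norm (w - 1) powr - b)"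
proof -
  obtain b c R where b: "0 < b" "b < 1" and far: "\<And>w. w \<in> upper_half_plane \<Longrightarrow> R \<le> norm w \<Longrightarrow>
      norm ((F w - 1) / w) \<le> c * norm (w - 1) powr - b"
    using growth_far quotient_bound_far[where A = upper_half_plane] by metis
  obtain a d \<delta> where a: "0 < a" "a < 1" and \<delta>: "0 < \<delta>" and
    near: "\<And>w. w \<in> upper_half_plane \<Longrightarrow> norm (w - 1) < \<delta> \<Longrightarrow>
      norm ((F w - 1) / w) \<le> d * norm (w - 1) powr - a"
    using growth_near quotient_bound_near[where A = upper_half_plane and f = F]
    by (metis upper_half_plane_def mem_Collect_eq one_complex.sel(2) less_irrefl)
  have g: "g w = (F w - 1) / w" if "0 < Im w" for w
    using that by (auto simp: g_upper q_def)
  show thesis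
    using closed_upper_half_plane_bound[OF g_continuous, of R c b \<delta> d a] far near \<delta> that[OF a b]
    by (auto simp: upper_half_plane_def g)
qed

text \<open>Since F is real to the left of 1, only the slit contributes an imaginary part, and there
  Im ((Fp - 1)/x) = v(x)/x.\<close>

lemma upper_half_plane_formula:
  assumes z: "0 < Im z"
  shows "set_integrable lborel {1<..} (\<lambda>x. of_real (v x / x) / (of_real x - z))"
    and "q z = (LINT x:{1<..}|lborel. of_real (v x / x) / (of_real x - z)) / of_real pi"
proof -
  obtain a b K where ab: "0 < a" "a < 1" "0 < b" "b < 1" "0 \<le> K" and
    bd: "\<And>w. 0 \<le> Im w \<Longrightarrow> w \<noteq> 1 \<Longrightarrow> norm (g w) \<le> K * (norm (w - 1) powr - a + norm (w - 1) powr - b)"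
    using g_bound by blast
  have Im_q: "Im (q (of_real x)) = 0" if "x < 1" "x \<noteq> 0" for x :: real
  proof -
    have "(F (of_real x) - 1) / of_real x \<in> \<real>"
      by (intro Reals_divide Reals_diff F_real that) auto
    then show ?thesis using that by (simp add: q_def complex_is_Real_iff)
  qed
  \<comment> \<open>Two points are discarded: at 0 the value of \<open>g\<close> is a derivative
    rather than a quotient, and at 1 it involves the uncontrolled value of \<open>F\<close>
    there.\<close>
  have eq: "AE x in lborel. of_real (Im (g (of_real x))) / (of_real x - z)
      = indicator {1<..} x *\<^sub>R (of_real (v x / x) / (of_real x - z))"
    using AE_lborel_singleton[of 0] AE_lborel_singleton[of 1]
    by eventually_elim (auto simp: g_def v_def indicator_def Im_divide_of_real Im_q)
  note * = upper_half_plane_eq_integral_Im[of g 1 K a b z, unfolded of_real_1,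
      OF g_holomorphic g_continuous bd ab z]
  have "(\<lambda>x. indicator {1<..} x *\<^sub>R (of_real (v x / x) / (of_real x - z))) \<in> borel_measurable borel"
    using z by (intro borel_measurable_continuous_on_indicator continuous_intros continuous_on_v)
      (auto simp: complex_eq_iff)
  then have m':
      "(\<lambda>x. indicator {1<..} x *\<^sub>R (of_real (v x / x) / (of_real x - z))) \<in> borel_measurable lborel"
    by simp
  have m: "(\<lambda>x. of_real (Im (g (of_real x))) / (of_real x - z)) \<in> borel_measurable lborel"
    using *(1) by simp
  show "set_integrable lborel {1<..} (\<lambda>x. of_real (v x / x) / (of_real x - z))"
    unfolding set_integrable_def
    by (rule integrable_cong_AE_imp[OF *(1) m']) (use eq in \<open>auto elim: eventually_mono\<close>)
  have "(\<integral>x. of_real (Im (g (of_real x))) / (of_real x - z) \<partial>lborel)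
      = (LINT x:{1<..}|lborel. of_real (v x / x) / (of_real x - z))"
    unfolding set_lebesgue_integral_def by (rule integral_cong_AE[OF m m' eq])
  then show "q z = (LINT x:{1<..}|lborel. of_real (v x / x) / (of_real x - z)) / of_real pi"
    using *(2) g_upper[OF z] by simp
qed

end

text \<open>A zero would put 1 = t z into the slit plane; compactness of [0,1] turns nonvanishing
  into a positive minimum.\<close>

lemma one_minus_mult_bounded_below:
  assumes "z \<in> slit_plane"
  obtains m where "0 < m" "\<And>t. t \<in> {0..1} \<Longrightarrow> m \<le> norm (1 - of_real t * z)"
proof -
  have nz: "1 - of_real t * z \<noteq> 0" if "t \<in> {0..1}" for t :: real
  proof
    assume "1 - of_real t * z = 0"
    then have "1 \<in> slit_plane" using scaleR_slit_plane[OF assms, of t] that by simp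
    then show False by (simp add: slit_plane_iff)
  qed
  have "continuous_on {0..1::real} (\<lambda>t. norm (1 - of_real t * z))"
    by (intro continuous_intros)
  then obtain s where s: "s \<in> {0..1::real}"
    "\<forall>t\<in>{0..1}. norm (1 - of_real s * z) \<le> norm (1 - of_real t * z)"
    using continuous_attains_inf[OF compact_Icc, of 0 "1::real" "\<lambda>t. norm (1 - of_real t * z)"]
    by fastforce
  show thesis using that[of "norm (1 - of_real s * z)"] s nz by auto
qed

section \<open>From the upper half-plane to the slit plane, and the limit at 1\<close>

context slit_function
begin

text \<open>This is \<open>t\<close> times the density \<open>w\<close>: it is integrable without any sign condition, unlike \<open>w\<close>.\<close>

definition u :: "real \<Rightarrow> real" where
  "u t = v (1 / t) / pi"

lemma u_measurable [measurable]: "(\<lambda>t. indicator {0<..<1} t * u t) \<in> borel_measurable borel"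
proof -
  have "continuous_on {0<..<1} u"
    unfolding u_def
    by (intro continuous_intros continuous_on_compose2[OF continuous_on_v]) auto
  then show ?thesis
    using borel_measurable_continuous_on_indicator[of "{0<..<1}" u] by simp
qed

text \<open>Under x = 1/t the factor 1/t^2 cancels against the two powers of t produced by 1/x and
  1/(x - z), leaving v(1/t)/(1 - t z).\<close>

lemma q_upper:
  assumes z: "0 < Im z"
  shows "set_integrable lborel {0<..<1} (\<lambda>t. of_real (u t) / (1 - of_real t * z))"
    and "q z = (LINT t:{0<..<1}|lborel. of_real (u t) / (1 - of_real t * z))"
proof -
  let ?f = "\<lambda>x. of_real (v x / x) / (of_real x - z)"
  have eq: "(1 / t\<^sup>2) *\<^sub>R ?f (1 / t) = of_real pi * (of_real (u t) / (1 - of_real t * z))"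
    if "t \<in> {0<..<1}" for t :: real
  proof -
    have "of_real (1 / t) - z = (1 - of_real t * z) / of_real t"
      using that by (simp add: field_simps)
    then show ?thesis
      using that by (simp add: u_def scaleR_conv_of_real power2_eq_square)
  qed
  note sub = set_integral_substitution_inverse[OF upper_half_plane_formula(1)[OF z]]
  have i: "set_integrable lborel {0<..<1} (\<lambda>t. of_real pi * (of_real (u t) / (1 - of_real t * z)))"
    using sub(1) eq by (subst set_integrable_cong[OF refl refl eq[symmetric]]) auto
  then show "set_integrable lborel {0<..<1} (\<lambda>t. of_real (u t) / (1 - of_real t * z))"
    by (subst (asm) set_integrable_mult_right_iff) auto
  have "(LINT t:{0<..<1}|lborel. of_real pi * (of_real (u t) / (1 - of_real t * z)))
      = (LINT x:{1<..}|lborel. ?f x)"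
    unfolding sub(2)[symmetric] by (rule set_lebesgue_integral_cong) (use eq in auto)
  then have "of_real pi * (LINT t:{0<..<1}|lborel. of_real (u t) / (1 - of_real t * z))
      = of_real pi * q z"
    unfolding upper_half_plane_formula(2)[OF z] set_integral_mult_right by simp
  then show "q z = (LINT t:{0<..<1}|lborel. of_real (u t) / (1 - of_real t * z))"
    by simp
qed

text \<open>The case z = i of the previous formula suffices, because |1 - t i| <= 2 makes the kernel
  bounded below in modulus.\<close>

lemma u_integrable: "set_integrable lborel {0<..<1} u"
  unfolding set_integrable_def
proof (rule Bochner_Integration.integrable_bound)
  show "integrable lborel (\<lambda>t. 2 * norm (indicator {0<..<1} t *\<^sub>R (of_real (u t) / (1 - of_real t * \<i>))))"
    using q_upper(1)[of \<i>] unfolding set_integrable_def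
    by (intro integrable_mult_right integrable_norm) simp
  show "AE t in lborel. norm (indicator {0<..<1} t *\<^sub>R u t)
      \<le> norm (2 * norm (indicator {0<..<1} t *\<^sub>R (complex_of_real (u t) / (1 - of_real t * \<i>))))"
  proof (rule AE_I2)
    fix t :: real
    have "norm (1 - of_real t * \<i>) \<le> 2 \<and> 0 < norm (1 - of_real t * \<i>)" if "0 < t" "t < 1"
      using norm_triangle_ineq4[of 1 "of_real t * \<i>"] that by (auto simp: norm_mult complex_eq_iff)
    then show "norm (indicator {0<..<1} t *\<^sub>R u t)
      \<le> norm (2 * norm (indicator {0<..<1} t *\<^sub>R (complex_of_real (u t) / (1 - of_real t * \<i>))))"
      using mult_left_mono[of "norm (1 - of_real t * \<i>)" 2 "\<bar>u t\<bar>"]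
      by (auto simp: indicator_def norm_divide le_divide_eq mult.commute)
  qed
qed simp

lemma kernel_integrable:
  assumes "z \<in> slit_plane"
  shows "set_integrable lborel {0<..<1} (\<lambda>t. of_real (u t) / (1 - of_real t * z))"
proof -
  obtain m where m: "0 < m" "\<And>t. t \<in> {0..1} \<Longrightarrow> m \<le> norm (1 - of_real t * z)"
    using one_minus_mult_bounded_below[OF assms] by blast
  have eq: "(\<lambda>t. indicator {0<..<1} t *\<^sub>R (of_real (u t) / (1 - of_real t * z)))
      = (\<lambda>t. of_real (indicator {0<..<1} t * u t) / (1 - of_real t * z))"
    by (auto simp: scaleR_conv_of_real)
  show ?thesis
    unfolding set_integrable_def eq
  proof (rule Bochner_Integration.integrable_bound)
    show "integrable lborel (\<lambda>t. (indicator {0<..<1} t * u t) / m)"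
      using u_integrable unfolding set_integrable_def by (intro integrable_divide) simp
    show "AE t in lborel. norm (of_real (indicator {0<..<1} t * u t) / (1 - of_real t * z))
        \<le> norm ((indicator {0<..<1} t * u t) / m)"
      using m by (intro AE_I2) (auto simp: indicator_def norm_divide intro!: frac_le)
  qed measurable
qed

text \<open>Identity theorem: F and its reflection cnj F(cnj z) are holomorphic on the connected
  slit plane and agree on the reals below 1, which accumulate at 0.\<close>

lemma cnj_F:
  assumes z: "z \<in> slit_plane"
  shows "F (cnj z) = cnj (F z)"
proof -
  have hol: "(\<lambda>w. F w - (cnj \<circ> F \<circ> cnj) w) holomorphic_on slit_plane"
  proof (intro holomorphic_on_diff holomorphic)
    have "cnj ` slit_plane = slit_plane"
      by (auto simp: slit_plane_iff image_iff intro!: bexI[of _ "cnj x" for x])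
    then show "(cnj \<circ> F \<circ> cnj) holomorphic_on slit_plane"
      using holomorphic holomorphic_on_compose_cnj_cnj[of F slit_plane] open_slit_plane by simp
  qed
  have eq: "F w - (cnj \<circ> F \<circ> cnj) w = 0" if "w \<in> of_real ` {..<1}" for w
    using that F_real by (auto simp: Reals_cnj_iff)
  have lim: "(0::complex) islimpt of_real ` {..<1}"
    unfolding islimpt_approachable
  proof (intro allI impI)
    fix e :: real assume "0 < e"
    then have "complex_of_real (- e / 2) \<noteq> 0 \<and> dist (complex_of_real (- e / 2)) 0 < e"
      "complex_of_real (- e / 2) \<in> of_real ` {..<1}"
      by (simp, intro imageI) auto
    then show "\<exists>x'\<in>of_real ` {..<1}. x' \<noteq> 0 \<and> dist x' (0::complex) < e"
      by blast
  qed
  have "F (cnj z) - (cnj \<circ> F \<circ> cnj) (cnj z) = 0"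
    by (rule analytic_continuation[OF hol open_slit_plane connected_slit_plane _ _ lim eq])
       (use z in \<open>auto simp: slit_plane_iff\<close>)
  then show ?thesis by simp
qed

text \<open>The lower half-plane follows by reflection, since \<open>u\<close> is real. Real points
  are limits of points above them, where dominated convergence applies.\<close>

lemma q_formula:
  assumes z: "z \<in> slit_plane"
  shows "q z = (LINT t:{0<..<1}|lborel. of_real (u t) / (1 - of_real t * z))"
proof -
  consider "0 < Im z" | "Im z < 0" | "Im z = 0" by linarith
  then show ?thesis
  proof cases
    case 1
    then show ?thesis by (rule q_upper)
  next
    case 2
    then have "q z = cnj (q (cnj z))"
      using cnj_F[OF z] by (auto simp: q_def)
    also have "\<dots> = (LINT t:{0<..<1}|lborel. cnj (of_real (u t) / (1 - of_real t * cnj z)))"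
      using 2 unfolding set_lebesgue_integral_def
      by (subst q_upper(2)) (auto simp: set_lebesgue_integral_def simp flip: Bochner_Integration.integral_cnj)
    finally show ?thesis by simp
  next
    case 3
    then have z1: "Re z < 1" using z by (simp add: slit_plane_iff)
    \<comment> \<open>A lower bound for 1 - t Re z over 0 < t < 1, hence for |1 - t w| along the
      whole vertical line through \<open>z\<close>.\<close>
    define m where "m = min 1 (1 - Re z)"
    have m: "0 < m" using z1 by (simp add: m_def)
    define zn where "zn n = z + \<i> * of_real (1 / real (Suc n))" for n
    have Im_zn: "0 < Im (zn n)" for n using 3 by (simp add: zn_def)
    have lim: "zn \<longlonglongrightarrow> z"
      unfolding zn_def
      using tendsto_add[OF tendsto_const[of z] tendsto_mult[OF tendsto_const[of \<i>]
        tendsto_of_real[OF LIMSEQ_inverse_real_of_nat]]] by (simp add: inverse_eq_divide)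
    have low: "m \<le> norm (1 - of_real t * w)" if "0 < t" "t < 1" "Re w = Re z" for t w
    proof -
      have "m \<le> 1 - t * Re z"
      proof (cases "0 \<le> Re z")
        case True
        then show ?thesis using that mult_left_le_one_le[of "Re z" t] by (auto simp: m_def)
      next
        case False
        then show ?thesis using that mult_pos_neg[of t "Re z"] by (auto simp: m_def)
      qed
      also have "\<dots> \<le> norm (1 - of_real t * w)"
        using complex_Re_le_cmod[of "1 - of_real t * w"] that by simp
      finally show ?thesis .
    qed
    have eq: "indicator {0<..<1} t *\<^sub>R (of_real (u t) / (1 - of_real t * w))
      = of_real (indicator {0<..<1} t * u t) / (1 - of_real t * w)" for t and w :: complex
      by (simp add: scaleR_conv_of_real)
    have "(\<lambda>n. LINT t:{0<..<1}|lborel. of_real (u t) / (1 - of_real t * zn n))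
        \<longlonglongrightarrow> (LINT t:{0<..<1}|lborel. of_real (u t) / (1 - of_real t * z))"
      unfolding set_lebesgue_integral_def eq
    proof (rule integral_dominated_convergence)
      show "integrable lborel (\<lambda>t. norm (indicator {0<..<1} t * u t) / m)"
        using u_integrable unfolding set_integrable_def by (intro integrable_divide integrable_norm) simp
      show "AE t in lborel. (\<lambda>n. of_real (indicator {0<..<1} t * u t) / (1 - of_real t * zn n))
          \<longlonglongrightarrow> of_real (indicator {0<..<1} t * u t) / (1 - of_real t * z)"
      proof (rule AE_I2)
        fix t :: real
        show "(\<lambda>n. of_real (indicator {0<..<1} t * u t) / (1 - of_real t * zn n))
          \<longlonglongrightarrow> of_real (indicator {0<..<1} t * u t) / (1 - of_real t * z)"
        proof (cases "0 < t \<and> t < 1")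
          case True
          then have "1 - of_real t * z \<noteq> 0" using low[of t z] m by auto
          then show ?thesis by (intro tendsto_intros lim)
        qed (auto simp: indicator_def)
      qed
      show "AE t in lborel. norm (of_real (indicator {0<..<1} t * u t) / (1 - of_real t * zn n))
          \<le> norm (indicator {0<..<1} t * u t) / m" for n
        using low[of _ "zn n"] m
        by (intro AE_I2) (auto simp: indicator_def norm_divide zn_def intro!: frac_le)
    qed measurable
    then have "(\<lambda>n. q (zn n)) \<longlonglongrightarrow> (LINT t:{0<..<1}|lborel. of_real (u t) / (1 - of_real t * z))"
      by (simp add: q_upper(2)[OF Im_zn])
    moreover have "(\<lambda>n. q (zn n)) \<longlonglongrightarrow> q z"
      using lim z Im_zn
      by (intro continuous_on_tendsto_compose[OF holomorphic_on_imp_continuous_on[OF q_holomorphic]])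
         (auto simp: slit_plane_iff less_imp_neq[symmetric])
    ultimately show ?thesis by (rule LIMSEQ_unique[rotated])
  qed
qed

text \<open>The bound on \<open>g\<close> reaches real points and has exponents below 1, so the
  factor 1 - x leaves positive powers of 1 - x. This is the absence of an atom at 1.\<close>

lemma tendsto_at_left_1: "((\<lambda>x::real. of_real (1 - x) * F (of_real x)) \<longlongrightarrow> 0) (at_left 1)"
proof -
  obtain a b K where ab: "0 < a" "a < 1" "0 < b" "b < 1" "0 \<le> K" and
    bd: "\<And>w. 0 \<le> Im w \<Longrightarrow> w \<noteq> 1 \<Longrightarrow> norm (g w) \<le> K * (norm (w - 1) powr - a + norm (w - 1) powr - b)"
    using g_bound by blast
  have "\<forall>\<^sub>F x in at_left (1::real). 0 < x \<and> x < 1"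
    by (intro eventually_conj eventually_at_left_field[THEN iffD2] exI[of _ 0]) auto
  then have "\<forall>\<^sub>F x in at_left (1::real). norm (of_real (1 - x) * F (of_real x))
      \<le> (1 - x) * (1 + K * ((1 - x) powr - a + (1 - x) powr - b))"
  proof eventually_elim
    case (elim x)
    have n: "norm (complex_of_real x - 1) = 1 - x" "norm (complex_of_real (1 - x)) = 1 - x"
      using elim norm_of_real[of "x - 1", where 'a = complex]
        norm_of_real[of "1 - x", where 'a = complex] by simp_all
    have "norm (F (of_real x)) \<le> 1 + norm (of_real x * g (of_real x))"
      using norm_triangle_ineq[of 1 "of_real x * g (of_real x)"] elim
      by (simp add: F_eq slit_plane_iff g_def)
    also have "norm (of_real x * g (of_real x)) \<le> norm (g (of_real x))"
      using elim by (simp add: norm_mult mult_left_le_one_le)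
    also have "\<dots> \<le> K * ((1 - x) powr - a + (1 - x) powr - b)"
      using bd[of "of_real x"] elim by (simp add: n)
    finally show ?case
      unfolding norm_mult n using elim by (simp add: mult_left_mono)
  qed
  moreover have "((\<lambda>x. (1 - x) * (1 + K * ((1 - x) powr - a + (1 - x) powr - b))) \<longlongrightarrow> 0) (at_left 1)"
  proof -
    have "((\<lambda>x::real. (1 - x) * (1 - x) powr - d) \<longlongrightarrow> 0) (at_left 1)" if "0 < d" "d < 1" for d
      using that by real_asymp
    then have "((\<lambda>x. (1 - x) + K * ((1 - x) * (1 - x) powr - a + (1 - x) * (1 - x) powr - b))
        \<longlongrightarrow> (1 - 1) + K * (0 + 0)) (at_left 1)"
      using ab by (intro tendsto_intros) auto
    then show ?thesis by (simp add: algebra_simps)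
  qed
  ultimately show ?thesis by (rule Lim_null_comparison)
qed

end

subsection \<open>The representing measure\<close>

context slit_function
begin

definition w :: "real \<Rightarrow> real" where
  "w t = v (1 / t) / (pi * t)"

text \<open>For y >= 0 this is 1 - F(-y). The kernel increases to 1 with y, so with a nonnegative
  density these integrals exhaust the mass of \<open>w\<close>.\<close>

definition \<Phi> :: "real \<Rightarrow> real" where
  "\<Phi> y = (LINT t:{0<..<1}|lborel. w t * (t * y / (1 + t * y)))"

lemma u_eq: "t \<in> {0<..<1} \<Longrightarrow> u t = w t * t"
  by (simp add: u_def w_def)

lemma w_measurable [measurable]: "(\<lambda>t. indicator {0<..<1} t * w t) \<in> borel_measurable borel"
proof -
  have "(\<lambda>t. (indicator {0<..<1} t * u t) / t) \<in> borel_measurable borel" by measurable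
  also have "(\<lambda>t. (indicator {0<..<1} t * u t) / t) = (\<lambda>t. indicator {0<..<1} t * w t)"
    by (auto simp: u_def w_def indicator_def)
  finally show ?thesis .
qed

text \<open>The kernel is at most t y, so the integrand is dominated by y |u|; integrability of
  \<open>w\<close> itself is established only later.\<close>

lemma \<Phi>_integrable:
  assumes "0 \<le> y"
  shows "set_integrable lborel {0<..<1} (\<lambda>t. w t * (t * y / (1 + t * y)))"
  unfolding set_integrable_def
proof (rule Bochner_Integration.integrable_bound)
  show "integrable lborel (\<lambda>t. y * (indicator {0<..<1} t * u t))"
    using u_integrable unfolding set_integrable_def by (intro integrable_mult_right) simp
  have "(\<lambda>t. (indicator {0<..<1} t * w t) * (t * y / (1 + t * y))) \<in> borel_measurable borel"
    by measurable
  then show "(\<lambda>t. indicator {0<..<1} t *\<^sub>R (w t * (t * y / (1 + t * y)))) \<in> borel_measurable lborel"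
    by (simp add: mult.assoc)
  show "AE t in lborel. norm (indicator {0<..<1} t *\<^sub>R (w t * (t * y / (1 + t * y))))
      \<le> norm (y * (indicator {0<..<1} t * u t))"
  proof (rule AE_I2)
    fix t :: real
    have "t * y / (1 + t * y) \<le> t * y" "0 \<le> t * y / (1 + t * y)" if "0 < t"
      using assms that by (auto simp: divide_le_eq mult_le_cancel_left1 add_pos_nonneg)
    then show "norm (indicator {0<..<1} t *\<^sub>R (w t * (t * y / (1 + t * y))))
      \<le> norm (y * (indicator {0<..<1} t * u t))"
      using assms mult_left_mono[of "t * y / (1 + t * y)" "t * y" "\<bar>w t\<bar>"]
      by (auto simp: indicator_def u_eq abs_mult mult_ac)
  qed
qed

lemma F_minus_of_real:
  assumes "0 \<le> y"
  shows "F (of_real (- y)) = of_real (1 - \<Phi> y)"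
proof -
  have z: "complex_of_real (- y) \<in> slit_plane" using assms by (simp add: slit_plane_iff)
  have "q (of_real (- y)) = (LINT t:{0<..<1}|lborel. complex_of_real (u t / (1 + t * y)))"
    unfolding q_formula[OF z] by simp
  also have "\<dots> = of_real (LINT t:{0<..<1}|lborel. u t / (1 + t * y))"
    by (rule set_integral_complex_of_real)
  finally have "F (of_real (- y)) = of_real (1 - y * (LINT t:{0<..<1}|lborel. u t / (1 + t * y)))"
    using F_eq[OF z] by simp
  also have "y * (LINT t:{0<..<1}|lborel. u t / (1 + t * y)) = (LINT t:{0<..<1}|lborel. y * (u t / (1 + t * y)))"
    unfolding set_integral_mult_right ..
  also have "\<dots> = \<Phi> y"
    unfolding \<Phi>_def by (rule set_lebesgue_integral_cong) (auto simp: u_eq)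
  finally show ?thesis .
qed

section \<open>Finite mass and the measure, under the sign and limsup conditions\<close>

context
  assumes v_nonneg: "\<And>x. 1 < x \<Longrightarrow> 0 \<le> v x"
    and limsup_nonneg: "Limsup at_bot (\<lambda>x::real. ereal (Re (F (of_real x)))) \<ge> 0"
begin

lemma w_nonneg: "t \<in> {0<..<1} \<Longrightarrow> 0 \<le> w t"
  by (auto simp: w_def intro!: divide_nonneg_nonneg v_nonneg)

lemma kernel_mono:
  fixes t x y :: real
  assumes "0 < t" "0 \<le> x" "x \<le> y"
  shows "t * x / (1 + t * x) \<le> t * y / (1 + t * y)"
proof -
  have "0 < 1 + t * x" "0 < 1 + t * y" using assms by (auto intro: add_pos_nonneg)
  then show ?thesis using assms by (simp add: divide_le_eq le_divide_eq field_simps)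
qed

lemma \<Phi>_mono:
  assumes "0 \<le> x" "x \<le> y"
  shows "\<Phi> x \<le> \<Phi> y"
  unfolding \<Phi>_def using assms
  by (intro set_integral_mono \<Phi>_integrable mult_left_mono kernel_mono w_nonneg) auto

text \<open>If the value at \<open>y\<close> exceeded 1, monotonicity would keep F below a fixed
  negative number on all of (-infinity, -y], against the limsup condition.\<close>

lemma \<Phi>_le_1:
  assumes "0 \<le> y"
  shows "\<Phi> y \<le> 1"
proof (rule ccontr)
  assume "\<not> \<Phi> y \<le> 1"
  have "\<forall>\<^sub>F x in at_bot. x \<le> - y" by (rule eventually_le_at_bot)
  then have "\<forall>\<^sub>F x in at_bot. ereal (Re (F (of_real x))) \<le> ereal (1 - \<Phi> y)"
  proof eventually_elim
    case (elim x)
    then show ?case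
      using F_minus_of_real[of "- x"] \<Phi>_mono[of y "- x"] assms by simp
  qed
  then have "Limsup at_bot (\<lambda>x. ereal (Re (F (of_real x)))) \<le> ereal (1 - \<Phi> y)"
    by (rule Limsup_bounded)
  then have "0 \<le> ereal (1 - \<Phi> y)" by (rule order_trans[OF limsup_nonneg])
  with \<open>\<not> \<Phi> y \<le> 1\<close> show False by simp
qed

lemma kernel_tendsto: "0 < t \<Longrightarrow> ((\<lambda>y. t * y / (1 + t * y)) \<longlongrightarrow> 1) at_top" for t :: real
  by real_asymp

text \<open>Monotone convergence along integer \<open>y\<close>: the integrals increase and stay
  below 1, which gives integrability of the limit and the bound on its mass together.\<close>

lemma w_integrable: "set_integrable lborel {0<..<1} w"
  and w_integral_le_1: "(LINT t:{0<..<1}|lborel. w t) \<le> 1"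
proof -
  define f where "f n t = indicator {0<..<1} t *\<^sub>R (w t * (t * real n / (1 + t * real n)))" for n t
  have "incseq (\<lambda>n. \<Phi> (real n))" by (auto intro!: monoI \<Phi>_mono)
  then obtain L where L: "(\<lambda>n. \<Phi> (real n)) \<longlonglongrightarrow> L"
    using incseq_convergent[of "\<lambda>n. \<Phi> (real n)" 1] \<Phi>_le_1 by (metis of_nat_0_le_iff)
  have L1: "L \<le> 1" by (rule LIMSEQ_le_const2[OF L]) (auto intro!: \<Phi>_le_1)
  have mono: "AE t in lborel. mono (\<lambda>n. f n t)"
    unfolding f_def
    by (intro AE_I2 monoI) (auto simp: indicator_def simp del: times_divide_eq_right
        intro!: mult_left_mono kernel_mono w_nonneg)
  have lim: "AE t in lborel. (\<lambda>n. f n t) \<longlonglongrightarrow> indicator {0<..<1} t *\<^sub>R w t"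
  proof (rule AE_I2)
    fix t :: real
    show "(\<lambda>n. f n t) \<longlonglongrightarrow> indicator {0<..<1} t *\<^sub>R w t"
    proof (cases "t \<in> {0<..<1}")
      case True
      then have "(\<lambda>n. w t * (t * real n / (1 + t * real n))) \<longlonglongrightarrow> w t * 1"
        by (intro tendsto_intros filterlim_compose[OF kernel_tendsto filterlim_real_sequentially]) auto
      then show ?thesis using True by (simp add: f_def)
    qed (simp add: f_def)
  qed
  have int: "integrable lborel (f n)" for n
    unfolding f_def using \<Phi>_integrable[of "real n"] by (simp add: set_integrable_def)
  have ilim: "(\<lambda>n. integral\<^sup>L lborel (f n)) \<longlonglongrightarrow> L"
    using L unfolding \<Phi>_def f_def set_lebesgue_integral_def .
  have m: "(\<lambda>t. indicator {0<..<1} t *\<^sub>R w t) \<in> borel_measurable lborel" by simp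
  show "set_integrable lborel {0<..<1} w"
    unfolding set_integrable_def by (rule integrable_monotone_convergence[OF int mono lim ilim m])
  show "(LINT t:{0<..<1}|lborel. w t) \<le> 1"
    unfolding set_lebesgue_integral_def
    using integral_monotone_convergence[OF int mono lim ilim m] L1 by simp
qed

text \<open>Now that \<open>w\<close> is integrable it serves as a majorant, and dominated
  convergence gives the limit along all real \<open>y\<close>.\<close>

lemma \<Phi>_tendsto: "(\<Phi> \<longlongrightarrow> (LINT t:{0<..<1}|lborel. w t)) at_top"
  unfolding \<Phi>_def[abs_def] set_lebesgue_integral_def
proof (rule integral_dominated_convergence_at_top)
  show "integrable lborel (\<lambda>t. indicator {0<..<1} t *\<^sub>R w t)"
    using w_integrable by (simp add: set_integrable_def)
  have "(\<lambda>t. (indicator {0<..<1} t * w t) * (t * y / (1 + t * y))) \<in> borel_measurable borel" for y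
    by measurable
  then show "(\<lambda>t. indicator {0<..<1} t *\<^sub>R (w t * (t * y / (1 + t * y)))) \<in> borel_measurable lborel" for y
    by (simp add: mult.assoc)
  show "(\<lambda>t. indicator {0<..<1} t *\<^sub>R w t) \<in> borel_measurable lborel" by simp
  show "AE t in lborel. ((\<lambda>y. indicator {0<..<1} t *\<^sub>R (w t * (t * y / (1 + t * y))))
      \<longlongrightarrow> indicator {0<..<1} t *\<^sub>R w t) at_top"
  proof (rule AE_I2)
    fix t :: real
    show "((\<lambda>y. indicator {0<..<1} t *\<^sub>R (w t * (t * y / (1 + t * y))))
      \<longlongrightarrow> indicator {0<..<1} t *\<^sub>R w t) at_top"
    proof (cases "t \<in> {0<..<1}")
      case True
      then have "((\<lambda>y. w t * (t * y / (1 + t * y))) \<longlongrightarrow> w t * 1) at_top"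
        by (intro tendsto_intros kernel_tendsto) auto
      then show ?thesis using True by simp
    qed simp
  qed
  show "\<forall>\<^sub>F y in at_top. AE t in lborel. norm (indicator {0<..<1} t *\<^sub>R (w t * (t * y / (1 + t * y))))
      \<le> indicator {0<..<1} t *\<^sub>R w t"
    using eventually_ge_at_top[of 0]
  proof eventually_elim
    case (elim y)
    show ?case
    proof (rule AE_I2)
      fix t :: real
      have "t * y / (1 + t * y) \<le> 1" "0 \<le> t * y / (1 + t * y)" if "0 < t"
        using elim that by (auto simp: divide_le_eq_1 add_pos_nonneg)
      then show "norm (indicator {0<..<1} t *\<^sub>R (w t * (t * y / (1 + t * y))))
        \<le> indicator {0<..<1} t *\<^sub>R w t"
        using w_nonneg[of t] elim mult_left_mono[of "t * y / (1 + t * y)" 1 "w t"]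
        by (auto simp: indicator_def abs_mult)
    qed
  qed
qed

definition \<alpha>\<^sub>0 :: real where
  "\<alpha>\<^sub>0 = 1 - (LINT t:{0<..<1}|lborel. w t)"

lemma F_tendsto_at_bot: "((\<lambda>x. F (of_real x)) \<longlongrightarrow> of_real \<alpha>\<^sub>0) at_bot"
  unfolding filterlim_at_bot_mirror
proof (rule Lim_transform_eventually)
  show "((\<lambda>y. complex_of_real (1 - \<Phi> y)) \<longlongrightarrow> of_real \<alpha>\<^sub>0) at_top"
    unfolding \<alpha>\<^sub>0_def by (intro tendsto_intros \<Phi>_tendsto)
  show "\<forall>\<^sub>F y in at_top. complex_of_real (1 - \<Phi> y) = F (of_real (- y))"
    using eventually_ge_at_top[of 0] by eventually_elim (rule F_minus_of_real[symmetric])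
qed

text \<open>From w/(1 - t z) = w + z u/(1 - t z), the integral is the mass of \<open>w\<close> plus
  z q(z); \<open>\<alpha>\<^sub>0\<close> completes that mass to the 1 in F = 1 + z q.\<close>

lemma F_formula:
  assumes z: "z \<in> slit_plane"
  shows "F z = of_real \<alpha>\<^sub>0 + (LINT t:{0<..<1}|lborel. of_real (w t) * (1 / (1 - of_real t * z)))"
proof -
  have w_int: "set_integrable lborel {0<..<1} (\<lambda>t. complex_of_real (w t))"
    using integrable_of_real[OF w_integrable[unfolded set_integrable_def], where 'a = complex]
    by (simp add: set_integrable_def scaleR_conv_of_real)
  have "(LINT t:{0<..<1}|lborel. of_real (w t) * (1 / (1 - of_real t * z)))
      = (LINT t:{0<..<1}|lborel. of_real (w t) + z * (of_real (u t) / (1 - of_real t * z)))"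
  proof (rule set_lebesgue_integral_cong)
    show "\<forall>t. t \<in> {0<..<1} \<longrightarrow> of_real (w t) * (1 / (1 - of_real t * z))
        = of_real (w t) + z * (of_real (u t) / (1 - of_real t * z))"
    proof (intro allI impI)
      fix t :: real assume t: "t \<in> {0<..<1}"
      have "1 - of_real t * z \<noteq> 0"
        using one_minus_mult_bounded_below[OF z] t
        by (metis atLeastAtMost_iff greaterThanLessThan_iff less_imp_le norm_zero not_less)
      then show "of_real (w t) * (1 / (1 - of_real t * z))
          = of_real (w t) + z * (of_real (u t) / (1 - of_real t * z))"
        using t by (simp add: u_eq field_simps)
    qed
  qed simp
  also have "\<dots> = (LINT t:{0<..<1}|lborel. complex_of_real (w t))
      + (LINT t:{0<..<1}|lborel. z * (of_real (u t) / (1 - of_real t * z)))"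
    by (intro set_integral_add set_integrable_mult_right w_int kernel_integrable[OF z])
  also have "\<dots> = of_real (LINT t:{0<..<1}|lborel. w t) + z * q z"
    unfolding set_integral_complex_of_real set_integral_mult_right q_formula[OF z] ..
  finally show ?thesis unfolding \<alpha>\<^sub>0_def F_eq[OF z] by simp
qed

text \<open>The kernel 1/(1 - t z) is continuous on [0,1] and equals 1 at t = 0, so the atom
  contributes exactly \<open>\<alpha>\<^sub>0\<close>.\<close>

lemma representing_measure:
  obtains \<mu> where "borel_prob_unit_interval \<mu>" "has_decomposition \<mu> \<alpha>\<^sub>0 0 w" "represents \<mu> F"
proof -
  have "0 \<le> \<alpha>\<^sub>0" using w_integral_le_1 by (simp add: \<alpha>\<^sub>0_def)
  moreover have "\<alpha>\<^sub>0 + (LINT t:{0<..<1}|lborel. w t) = 1" by (simp add: \<alpha>\<^sub>0_def)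
  ultimately obtain \<mu> where \<mu>: "borel_prob_unit_interval \<mu>" "has_decomposition \<mu> \<alpha>\<^sub>0 0 w"
    and int: "\<And>f :: real \<Rightarrow> complex. continuous_on {0..1} f \<Longrightarrow>
      (\<integral>t. f t \<partial>\<mu>) = of_real \<alpha>\<^sub>0 * f 0 + (LINT t:{0<..<1}|lborel. of_real (w t) * f t)"
    using unit_interval_measure_exists[OF _ w_nonneg w_integrable] by blast
  have "F z = (\<integral>t. 1 / (1 - of_real t * z) \<partial>\<mu>)" if z: "z \<in> slit_plane" for z
  proof -
    have "continuous_on {0..1} (\<lambda>t. 1 / (1 - complex_of_real t * z))"
      using one_minus_mult_bounded_below[OF z]
      by (intro continuous_intros) (metis norm_zero not_less)
    then show ?thesis using F_formula[OF z] by (simp add: int)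
  qed
  with \<mu> that show thesis unfolding represents_def by blast
qed

end

end

section \<open>The representation with its two boundary limits\<close>

theorem theorem2p6:
  fixes F Fp :: "complex \<Rightarrow> complex"
  assumes "F analytic_on slit_plane"
    and "F 0 = 1"
    and "extends_across_slit F Fp"
    and "\<And>x::real. x < 1 \<Longrightarrow> F (complex_of_real x) \<in> \<real>"
    and "Limsup at_bot (\<lambda>x::real. ereal (Re (F (complex_of_real x)))) \<ge> 0"
    and "\<And>x::real. x > 1 \<Longrightarrow> Im (Fp (complex_of_real x)) \<ge> 0"
    and "\<exists>\<alpha>::real. \<alpha> < 1 \<and>
           F \<in> O[inf at_infinity (principal upper_half_plane)](\<lambda>z. complex_of_real (norm z powr \<alpha>))"
    and "\<exists>\<alpha>::real. \<alpha> < 1 \<and>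
           F \<in> O[at 1 within upper_half_plane](\<lambda>z. complex_of_real (norm (z - 1) powr (- \<alpha>)))"
  shows "F \<in> class_T \<and>
    (\<exists>\<alpha>\<^sub>0 \<alpha>\<^sub>1 :: real.
       ((\<lambda>x::real. F (complex_of_real x)) \<longlongrightarrow> complex_of_real \<alpha>\<^sub>0) at_bot \<and>
       ((\<lambda>x::real. complex_of_real (1 - x) * F (complex_of_real x)) \<longlongrightarrow> complex_of_real \<alpha>\<^sub>1)
         (at_left 1) \<and>
       (\<exists>\<mu>. borel_prob_unit_interval \<mu> \<and>
            has_decomposition \<mu> \<alpha>\<^sub>0 \<alpha>\<^sub>1
              (\<lambda>t. Im (Fp (complex_of_real (1 / t))) / (pi * t)) \<and>
            represents \<mu> F))"
proof -
  interpret slit_function F Fp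
    by unfold_locales (use assms in auto)
  have v: "0 \<le> v x" if "1 < x" for x using assms(6)[OF that] by (simp add: v_def)
  obtain \<mu> where \<mu>: "borel_prob_unit_interval \<mu>" "has_decomposition \<mu> \<alpha>\<^sub>0 0 w" "represents \<mu> F"
    using representing_measure[OF v assms(5)] by blast
  have w: "w = (\<lambda>t. Im (Fp (complex_of_real (1 / t))) / (pi * t))"
    by (simp add: w_def v_def fun_eq_iff)
  have "F \<in> class_T" unfolding class_T_def using assms(1) \<mu> by blast
  moreover have "((\<lambda>x. F (of_real x)) \<longlongrightarrow> of_real \<alpha>\<^sub>0) at_bot"
    by (rule F_tendsto_at_bot[OF v assms(5)])
  \<comment> \<open>The witness for \<open>\<alpha>\<^sub>1\<close> is 0, matching the zero atom at
    1 in the decomposition.\<close>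
  moreover have "((\<lambda>x. of_real (1 - x) * F (of_real x)) \<longlongrightarrow> of_real 0) (at_left 1)"
    using tendsto_at_left_1 by simp
  ultimately show ?thesis
    using \<mu> unfolding w by blast
qed

end
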